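(* For every positive integer $k$ there exists $\varepsilon=\varepsilon_k>0$ such that for infinitely many integers $n$ there exists a $3$-graph $H$ with vertex partition $V(H)=A\cup B$, $|A|=|B|=n$, such that every edge of $H$ has exactly two vertices in $A$ and one in $B$, and: (C1) $d_H(\{a_1,a_2\})\ge\varepsilon n$ for any two distinct vertices $a_1,a_2\in A$; (C2) $d_H(\{a,b\})\ge\varepsilon n$ for every $a\in A$ and $b\in B$; (C3) $H$ contains no copy of any $3$-graph $F$ with $|V(F)|\le k$ and $\pi_{\text{unif}}(F)>0$.
   Context: A $3$-graph is a $3$-uniform hypergraph. For a $2$-subset $S\subseteq V(H)$, $d_H(S)$ is the number of edges of $H$ containing $S$. For $d\in[0,1]$ and $\eta>0$, an $n$-vertex $3$-graph $H$ is uniformly $(d,\eta)$-dense if for all $U\subseteq V(H)$, $|\binom{U}{3}\cap E(H)|\ge d\binom{|U|}{3}-\eta n^3$. The uniform Turán density $\pi_{\text{unif}}(F)$ is the supremum of all $d\in[0,1]$ such that for every $\eta>0$ and $n_0\in\mathbb{N}$ there exists an $F$-free uniformly $(d,\eta)$-dense $3$-graph $H$ with $|V(H)|\ge n_0$. A copy of $F$ in $H$ means a (not necessarily induced) subhypergraph of $H$ isomorphic to $F$. *)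

theory Defs
  imports Complex_Main
begin

definition three_graph :: "'a set \<Rightarrow> 'a set set \<Rightarrow> bool" where
  "three_graph V E \<longleftrightarrow> finite V \<and> (\<forall>e\<in>E. e \<subseteq> V \<and> card e = 3)"

definition codeg :: "'a set set \<Rightarrow> 'a set \<Rightarrow> nat" where
  "codeg E S = card {e\<in>E. S \<subseteq> e}"

definition has_copy :: "'b set \<Rightarrow> 'b set set \<Rightarrow> 'a set \<Rightarrow> 'a set set \<Rightarrow> bool" where
  "has_copy VF EF V E \<longleftrightarrow>
     (\<exists>f. inj_on f VF \<and> f ` VF \<subseteq> V \<and> (\<forall>e\<in>EF. f ` e \<in> E))"

definition unif_dense :: "real \<Rightarrow> real \<Rightarrow> 'a set \<Rightarrow> 'a set set \<Rightarrow> bool" where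
  "unif_dense d \<eta> V E \<longleftrightarrow>
     (\<forall>U\<subseteq>V. real (card {e\<in>E. e \<subseteq> U}) \<ge> d * real (card U choose 3) - \<eta> * real (card V) ^ 3)"

text \<open>Uniform Turan density; host 3-graphs are taken on vertex type nat (every finite
  3-graph is isomorphic to one on nat). The supremum of the empty set is read as 0.\<close>
definition pi_unif_set :: "'b set \<Rightarrow> 'b set set \<Rightarrow> real set" where
  "pi_unif_set VF EF = {d. 0 \<le> d \<and> d \<le> 1 \<and>
     (\<forall>\<eta>>0. \<forall>n0::nat. \<exists>(V::nat set) E. three_graph V E \<and> \<not> has_copy VF EF V E
        \<and> unif_dense d \<eta> V E \<and> card V \<ge> n0)}"

definition pi_unif :: "'b set \<Rightarrow> 'b set set \<Rightarrow> real" where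
  "pi_unif VF EF = (if pi_unif_set VF EF = {} then 0 else Sup (pi_unif_set VF EF))"

end

theory Submission
  imports Defs "HOL-Library.Ramsey"
begin

text \<open>
  The vertices of \<open>A\<close> are split into \<open>2 k + 1\<close> blocks arranged on a circle, and each \<open>b\<close> in \<open>B\<close> has
  one of the blocks as its centre. The link of \<open>b\<close> joins opposite blocks with respect to the centre,
  while inside the central block and towards its two neighbours it is directed by a row of a
  Sylvester--Hadamard matrix, which gives pairs in one block a common link. A subgraph \<open>F\<close> on at most
  \<open>k\<close> vertices misses a block; cutting the circle there orders \<open>V(F) \<inter> A\<close> linearly so that in every
  link each vertex has all its neighbours on one side.

  Such an \<open>F\<close> has uniform density zero. In a uniformly dense hypergraph there are a set \<open>Y\<close> and
  arbitrarily long sequences of vertices all of whose pairs have relative codegree at least \<open>\<delta>\<close> into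
  \<open>Y\<close>, with \<open>\<delta>\<close> independent of the length: otherwise one iteratively finds many equally large
  sets whose union spans too few edges. By Ramsey's theorem the joint link densities along the
  sequence can be made order invariant up to a small error. A second moment estimate then allows one
  to move the upper endpoints of link edges freely to the right, so that any pattern follows from the
  existence of complete bipartite patterns.
\<close>


subsection \<open>Homogeneous sequences and patterns\<close>

text \<open>One fixed linear order of \<open>A\<close> cannot serve all links. (C1) would join its
  last two vertices in some link; if that link is one-sided, the earlier of the two has a single
  neighbour there, against (C2) once \<open>n\<close> is large. On a circle no vertex is last, and
  (C3) concerns only subgraphs too small to meet every block, so an order is needed only after a
  cut. The number of blocks is odd so that 2 is invertible: any two blocks have a midpoint, and with
  it as centre they are opposite.

  One-sided links are an instance of the known criterion for uniform Turan density zero, which asks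
  for a vertex order and three colours on the pairs such that every edge x < y < z has the first
  colour on xy, the second on xz and the third on yz. Put the vertices of F in \<open>A\<close>
  first, use one colour among them, and colour a pair ab by whether a is a left or a right end in
  the link of b. Only this case of the criterion is established here, directly.\<close>

lemma pigeonhole_sum:
  fixes g :: "'a \<Rightarrow> real"
  assumes "finite S" "real (card S) \<le> s" "T > 0" "T \<le> sum g S"
  shows "\<exists>x\<in>S. T / s \<le> g x"
proof (rule ccontr)
  assume "\<not> ?thesis"
  then have less: "g x < T / s" if "x \<in> S" for x using that by force
  have "S \<noteq> {}" using assms by auto
  then have "s > 0" using assms by (metis card_gt_0_iff less_le_trans of_nat_0_less_iff)
  have "sum g S < (\<Sum>x\<in>S. T / s)"
    using less \<open>S \<noteq> {}\<close> assms(1) by (intro sum_strict_mono) auto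
  also have "\<dots> \<le> s * (T / s)"
    using mult_right_mono[OF assms(2), of "T / s"] assms(3) \<open>s > 0\<close> by simp
  also have "\<dots> = T" using \<open>s > 0\<close> by simp
  finally show False using assms by simp
qed

text \<open>Colouring increasing lists instead of sets lets a colour treat the entries by position.
  A set is coloured through its sorted list, which reduces the claim to Ramsey's theorem for
  \<open>r\<close>-sets. \<open>M\<close> is fixed before the colouring, so it serves all
  hypergraphs at once.\<close>

lemma Ramsey_increasing_lists:
  fixes cols :: "'c set" and m r :: nat
  assumes "finite cols"
  shows "\<exists>M::nat. \<forall>\<chi>::nat list \<Rightarrow> 'c. range \<chi> \<subseteq> cols \<longrightarrow>
    (\<exists>h. strict_mono_on {..<m} h \<and> h ` {..<m} \<subseteq> {..<M} \<and>
      (\<exists>c. \<forall>xs. sorted_wrt (<) xs \<and> length xs = r \<and> set xs \<subseteq> {..<m} \<longrightarrow> \<chi> (map h xs) = c))"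
proof -
  obtain enc :: "'c \<Rightarrow> nat" where enc: "bij_betw enc cols {0..<card cols}"
    using ex_bij_betw_finite_nat[OF assms] by blast
  obtain M :: nat where M: "partn_lst {..<M} (replicate (card cols) m) r"
    using ramsey_full by blast
  show ?thesis
  proof (intro exI[of _ M] allI impI)
    fix \<chi> :: "nat list \<Rightarrow> 'c"
    assume \<chi>: "range \<chi> \<subseteq> cols"
    define f where "f X = enc (\<chi> (sorted_list_of_set X))" for X
    have "f \<in> nsets {..<M} r \<rightarrow> {..<length (replicate (card cols) m)}"
      using enc \<chi> unfolding f_def bij_betw_def by fastforce
    then obtain i where "i < card cols" and mono: "monochromatic {..<M} m r f i"
      using M unfolding partn_lst_def by fastforce
    then obtain H where H: "H \<subseteq> {..<M}" "finite H" "card H = m" and col: "f ` nsets H r \<subseteq> {i}"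
      unfolding monochromatic_def nsets_def by blast
    define h where "h = (\<lambda>j. sorted_list_of_set H ! j)"
    have len: "length (sorted_list_of_set H) = m" using H by simp
    have sm: "strict_mono_on {..<m} h"
      using sorted_wrt_nth_less[OF strict_sorted_list_of_set, of _ _ H] len
      by (auto simp: strict_mono_on_def h_def)
    have hH: "h j \<in> H" if "j < m" for j
      using nth_mem[of j "sorted_list_of_set H"] that len H unfolding h_def by simp
    have "\<chi> (map h xs) = inv_into cols enc i"
      if xs: "sorted_wrt (<) xs" "length xs = r" "set xs \<subseteq> {..<m}" for xs
    proof -
      have sw: "sorted_wrt (<) (map h xs)"
        unfolding sorted_wrt_map using sm xs
        by (intro sorted_wrt_mono_rel[OF _ xs(1)]) (auto simp: strict_mono_on_def)
      have "set (map h xs) \<subseteq> H" using hH xs by auto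
      moreover have "card (set (map h xs)) = r"
        using sw xs by (metis distinct_card length_map strict_sorted_iff)
      ultimately have "set (map h xs) \<in> nsets H r" by (simp add: nsets_def)
      then have "f (set (map h xs)) = i" using col by blast
      moreover have "sorted_list_of_set (set (map h xs)) = map h xs"
        using sw by (metis sorted_list_of_set.idem_if_sorted_distinct strict_sorted_iff)
      ultimately have "enc (\<chi> (map h xs)) = i" by (simp add: f_def)
      then show ?thesis using enc \<chi> by (metis bij_betw_inv_into_left rangeI subsetD)
    qed
    then show "\<exists>h. strict_mono_on {..<m} h \<and> h ` {..<m} \<subseteq> {..<M} \<and>
      (\<exists>c. \<forall>xs. sorted_wrt (<) xs \<and> length xs = r \<and> set xs \<subseteq> {..<m} \<longrightarrow> \<chi> (map h xs) = c)"
      using sm hH H by (intro exI[of _ h]) auto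
  qed
qed

text \<open>With sign 1 on \<open>J1\<close> and -1 on \<open>J2\<close> the signs sum to zero, so
  the common correlation \<open>c\<close> cancels from the expanded square. What remains is at most
  \<theta> for each of the \<open>4 * N ^ 2\<close> pairs, plus \<open>card V\<close> for each of
  the \<open>2 * N\<close> diagonal ones.\<close>

lemma block_difference_second_moment:
  fixes f :: "'j \<Rightarrow> 'a \<Rightarrow> real"
  assumes "finite V" "finite J1" "finite J2" "card J1 = N" "card J2 = N" "J1 \<inter> J2 = {}"
    and f01: "\<And>j b. f j b \<in> {0, 1}"
    and c: "0 \<le> c" "c \<le> real (card V)" "0 \<le> \<theta>"
    and corr: "\<And>j j'. \<lbrakk>j \<in> J1 \<union> J2; j' \<in> J1 \<union> J2; j \<noteq> j'\<rbrakk> \<Longrightarrow> \<bar>(\<Sum>b\<in>V. f j b * f j' b) - c\<bar> \<le> \<theta>"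
  shows "(\<Sum>b\<in>V. ((\<Sum>j\<in>J1. f j b) - (\<Sum>j\<in>J2. f j b))\<^sup>2) \<le> 4 * real N ^ 2 * \<theta> + 2 * real N * real (card V)"
proof -
  define J where "J = J1 \<union> J2"
  define s :: "'j \<Rightarrow> real" where "s j = (if j \<in> J1 then 1 else -1)" for j
  define w where "w j j' = (\<Sum>b\<in>V. f j b * f j' b)" for j j'
  have fin: "finite J" and cJ: "card J = 2 * N" using assms by (auto simp: J_def card_Un_disjoint)
  have split: "(\<Sum>j\<in>J. s j * g j) = sum g J1 - sum g J2" for g
  proof -
    have "(\<Sum>j\<in>J2. s j * g j) = (\<Sum>j\<in>J2. - g j)"
      using assms by (intro sum.cong) (auto simp: s_def)
    then show ?thesis
      using assms by (simp add: J_def sum.union_disjoint s_def sum_negf)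
  qed
  have s0: "sum s J = 0" using split[of "\<lambda>_. 1"] assms by simp
  have "(\<Sum>b\<in>V. ((\<Sum>j\<in>J1. f j b) - (\<Sum>j\<in>J2. f j b))\<^sup>2) = (\<Sum>b\<in>V. (\<Sum>j\<in>J. s j * f j b)\<^sup>2)"
    by (simp add: split)
  also have "\<dots> = (\<Sum>b\<in>V. \<Sum>j\<in>J. \<Sum>j'\<in>J. s j * s j' * (f j b * f j' b))"
    by (simp add: power2_eq_square sum_product mult_ac)
  also have "\<dots> = (\<Sum>j\<in>J. \<Sum>j'\<in>J. \<Sum>b\<in>V. s j * s j' * (f j b * f j' b))"
    by (subst sum.swap, rule sum.cong[OF refl], subst sum.swap, simp)
  also have "\<dots> = (\<Sum>j\<in>J. \<Sum>j'\<in>J. s j * s j' * w j j')"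
    by (simp add: w_def sum_distrib_left)
  also have "\<dots> = (\<Sum>j\<in>J. \<Sum>j'\<in>J. s j * s j' * (w j j' - c)) + (\<Sum>j\<in>J. \<Sum>j'\<in>J. s j * s j' * c)"
    by (simp add: sum.distrib[symmetric] algebra_simps)
  also have "(\<Sum>j\<in>J. \<Sum>j'\<in>J. s j * s j' * c) = (\<Sum>j\<in>J. s j) * (\<Sum>j'\<in>J. s j') * c"
    by (simp add: sum_product sum_distrib_right[symmetric])
  also have "\<dots> = 0" by (simp add: s0)
  also have "(\<Sum>j\<in>J. \<Sum>j'\<in>J. s j * s j' * (w j j' - c))
      \<le> (\<Sum>j\<in>J. \<Sum>j'\<in>J. \<theta> + (if j' = j then real (card V) else 0))"
  proof (intro sum_mono)
    fix j j' assume j: "j \<in> J" "j' \<in> J"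
    have "s j * s j' * (w j j' - c) \<le> \<bar>w j j' - c\<bar>"
      by (auto simp: s_def)
    also have "\<dots> \<le> \<theta> + (if j' = j then real (card V) else 0)"
    proof (cases "j = j'")
      case True
      have "0 \<le> w j j'" unfolding w_def True by (intro sum_nonneg) simp
      moreover have "w j j' \<le> (\<Sum>b\<in>V. 1)"
        unfolding w_def using f01 by (intro sum_mono) (smt (verit) empty_iff insert_iff mult_cancel_left1 mult_eq_0_iff)
      ultimately show ?thesis using True c by (simp add: abs_le_iff)
    next
      case False
      then show ?thesis using corr[of j j'] j by (auto simp: w_def J_def)
    qed
    finally show "s j * s j' * (w j j' - c) \<le> \<theta> + (if j' = j then real (card V) else 0)" .
  qed
  also have "\<dots> = 4 * real N ^ 2 * \<theta> + 2 * real N * real (card V)"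
    using fin cJ by (simp add: sum.distrib power2_eq_square algebra_simps)
  finally show ?thesis by simp
qed

text \<open>Double counting: in every column at least a \<delta>/2 share of the \<open>b\<close>
  satisfy \<open>Q\<close> in \<open>t\<close> or more of the \<open>z\<close> rows. Each such
  column and \<open>b\<close> support some \<open>t\<close>-set of rows, and one of the at most
  \<open>2 ^ z\<close> such sets carries the average share.\<close>

lemma dense_columns_common_rows:
  fixes Q :: "nat \<Rightarrow> 'j \<Rightarrow> 'a \<Rightarrow> bool"
  assumes "finite V" "V \<noteq> {}" "finite J" "J \<noteq> {}" "\<delta> > 0" and "z > 0" and tz: "2 * real t \<le> \<delta> * real z"
    and dens: "\<And>e j. \<lbrakk>e < z; j \<in> J\<rbrakk> \<Longrightarrow> \<delta> * real (card V) \<le> real (card {b\<in>V. Q e j b})"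
  shows "\<exists>e. strict_mono_on {..<t} e \<and> e ` {..<t} \<subseteq> {..<z} \<and>
    \<delta> / 2 ^ (z + 1) * real (card J) * real (card V)
      \<le> (\<Sum>b\<in>V. real (card {j\<in>J. \<forall>i<t. Q (e i) j b}))"
proof -
  define rows where "rows j b = {e. e < z \<and> Q e j b}" for j b
  define rich where "rich j = {b\<in>V. t \<le> card (rows j b)}" for j
  have rows_le: "card (rows j b) \<le> z" for j b
    using card_mono[of "{..<z}" "rows j b"] by (auto simp: rows_def)
  have rich: "\<delta> / 2 * real (card V) \<le> real (card (rich j))" if "j \<in> J" for j
  proof -
    have "\<delta> * real (card V) * real z \<le> (\<Sum>e<z. real (card {b\<in>V. Q e j b}))"
      using sum_mono[of "{..<z}" "\<lambda>_. \<delta> * real (card V)" "\<lambda>e. real (card {b\<in>V. Q e j b})"] dens that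
      by (simp add: mult.commute)
    also have "\<dots> = (\<Sum>e<z. \<Sum>b\<in>V. of_bool (Q e j b))"
      using assms by (simp add: Int_def of_bool_def sum.If_cases Collect_conj_eq[symmetric])
    also have "\<dots> = (\<Sum>b\<in>V. \<Sum>e<z. of_bool (Q e j b))" by (rule sum.swap)
    also have "\<dots> = (\<Sum>b\<in>V. real (card (rows j b)))"
      by (simp add: rows_def Int_def of_bool_def sum.If_cases)
    also have "\<dots> \<le> (\<Sum>b\<in>V. real t + (if b \<in> rich j then real z else 0))"
      using rows_le by (intro sum_mono) (auto simp: rich_def intro: add_increasing)
    also have "\<dots> = real t * real (card V) + real z * real (card (rich j))"
      using assms by (simp add: sum.distrib sum.If_cases Int_def rich_def)
    finally have "\<delta> * real (card V) * real z \<le> \<delta> * real z / 2 * real (card V) + real z * real (card (rich j))"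
      using mult_right_mono[OF tz, of "real (card V)"] by simp
    then have "real z * (\<delta> / 2 * real (card V)) \<le> real z * real (card (rich j))"
      by (simp add: algebra_simps)
    then show ?thesis using \<open>z > 0\<close> by simp
  qed
  define g where "g P = (\<Sum>b\<in>V. real (card {j\<in>J. \<forall>e\<in>P. Q e j b}))" for P
  have "(\<delta> / 2 * real (card V)) * real (card J) \<le> (\<Sum>j\<in>J. real (card (rich j)))"
    using sum_mono[of J "\<lambda>_. \<delta> / 2 * real (card V)" "\<lambda>j. real (card (rich j))"] rich
    by (simp add: mult.commute)
  also have "\<dots> = (\<Sum>j\<in>J. \<Sum>b\<in>V. of_bool (t \<le> card (rows j b)))"
    using assms by (simp add: Int_def of_bool_def sum.If_cases Collect_conj_eq[symmetric] rich_def)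
  also have "\<dots> \<le> (\<Sum>j\<in>J. \<Sum>b\<in>V. \<Sum>P\<in>nsets {..<z} t. of_bool (\<forall>e\<in>P. Q e j b))"
  proof (intro sum_mono)
    fix j b
    show "of_bool (t \<le> card (rows j b)) \<le> (\<Sum>P\<in>nsets {..<z} t. of_bool (\<forall>e\<in>P. Q e j b) :: real)"
    proof (cases "t \<le> card (rows j b)")
      case True
      then obtain P where P: "P \<subseteq> rows j b" "card P = t" "finite P"
        using obtain_subset_with_card_n by metis
      then have "P \<in> nsets {..<z} t" by (auto simp: nsets_def rows_def)
      moreover have "\<forall>e\<in>P. Q e j b" using P by (auto simp: rows_def)
      ultimately have "of_bool (\<forall>e\<in>P. Q e j b) \<le> (\<Sum>P\<in>nsets {..<z} t. of_bool (\<forall>e\<in>P. Q e j b) :: real)"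
        by (intro member_le_sum) (auto simp: finite_imp_finite_nsets)
      with \<open>\<forall>e\<in>P. Q e j b\<close> True show ?thesis by simp
    qed (simp add: sum_nonneg)
  qed
  also have "\<dots> = (\<Sum>j\<in>J. \<Sum>P\<in>nsets {..<z} t. \<Sum>b\<in>V. of_bool (\<forall>e\<in>P. Q e j b))"
    by (intro sum.cong refl sum.swap)
  also have "\<dots> = (\<Sum>P\<in>nsets {..<z} t. \<Sum>j\<in>J. \<Sum>b\<in>V. of_bool (\<forall>e\<in>P. Q e j b))"
    by (rule sum.swap)
  also have "\<dots> = (\<Sum>P\<in>nsets {..<z} t. \<Sum>b\<in>V. \<Sum>j\<in>J. of_bool (\<forall>e\<in>P. Q e j b))"
    by (intro sum.cong refl sum.swap)
  also have "\<dots> = sum g (nsets {..<z} t)"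
    using assms by (simp add: g_def Int_def of_bool_def sum.If_cases Collect_conj_eq[symmetric])
  finally have tot: "(\<delta> / 2 * real (card V)) * real (card J) \<le> sum g (nsets {..<z} t)" .
  have "card (nsets {..<z} t) \<le> 2 ^ z"
    by (simp add: binomial_le_pow2)
  then have "real (card (nsets {..<z} t)) \<le> 2 ^ z"
    by (metis of_nat_le_iff of_nat_numeral of_nat_power)
  then obtain P where P: "P \<in> nsets {..<z} t" "(\<delta> / 2 * real (card V)) * real (card J) / 2 ^ z \<le> g P"
    using pigeonhole_sum[OF _ _ _ tot, of "2 ^ z"] assms
    by (auto simp: finite_imp_finite_nsets card_gt_0_iff)
  define e where "e = (\<lambda>i. sorted_list_of_set P ! i)"
  have P': "finite P" "card P = t" "P \<subseteq> {..<z}" using P by (auto simp: nsets_def)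
  have len: "length (sorted_list_of_set P) = t" using P' by simp
  have im: "e ` {..<t} = P"
    using P' len by (metis e_def atLeast0LessThan map_nth set_map set_sorted_list_of_set set_upt)
  have "strict_mono_on {..<t} e"
    using sorted_wrt_nth_less[OF strict_sorted_list_of_set, of _ _ P] len
    by (auto simp: strict_mono_on_def e_def)
  moreover have "g P = (\<Sum>b\<in>V. real (card {j\<in>J. \<forall>i<t. Q (e i) j b}))"
    unfolding g_def im[symmetric] by (intro sum.cong refl arg_cong[where f = "\<lambda>S. real (card S)"]) auto
  ultimately show ?thesis
    using P im P' by (intro exI[of _ e]) (auto simp: field_simps)
qed

section \<open>Prescribed left ends along a homogeneous sequence\<close>

text \<open>\<open>L\<close> collects the indices that may be left ends of link edges. Every
  one-sided link is contained in such a pattern, so it is enough to realise these.\<close>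

definition pattern_hits :: "'a set \<Rightarrow> (nat \<Rightarrow> nat \<Rightarrow> 'a \<Rightarrow> bool) \<Rightarrow> nat \<Rightarrow> nat set \<Rightarrow> (nat \<Rightarrow> nat) \<Rightarrow> 'a set" where
  "pattern_hits V D t L a = {b\<in>V. \<forall>j<t. \<forall>i<j. i \<in> L \<and> j \<notin> L \<longrightarrow> D (a i) (a j) b}"

text \<open>The indices are laid out as points \<open>e * W\<close>, each followed by a block of \<open>N\<close> indices. Members of \<open>L\<close>
  are taken from the points, the others from the blocks; by homogeneity the block after a point may be
  replaced by the last block, which lies to the right of all points.\<close>

lemma homogeneous_pattern:
  fixes V :: "'a set" and D :: "nat \<Rightarrow> nat \<Rightarrow> 'a \<Rightarrow> bool" and c :: "nat \<Rightarrow> real"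
    and t z N :: nat and \<delta> \<theta> :: real
  defines "W \<equiv> N + 1" and "\<kappa> \<equiv> \<delta> / 2 ^ (z + 1)"
  assumes V: "finite V" "V \<noteq> {}" and "\<delta> > 0" "z > 0" "N > 0" "\<theta> \<ge> 0"
    and tz: "2 * real t \<le> \<delta> * real z"
    and small: "4 / \<kappa>\<^sup>2 * (4 * \<theta> + 2 / real N) * real t \<le> \<kappa> / 4"
    and dens: "\<And>i j. \<lbrakk>i < j; j < (z + 1) * W\<rbrakk> \<Longrightarrow> \<delta> * real (card V) \<le> real (card {b\<in>V. D i j b})"
    and c: "\<And>q. q \<le> t \<Longrightarrow> 0 \<le> c q \<and> c q \<le> real (card V)"
    and hom: "\<And>I j j'. \<lbrakk>I \<subseteq> {..<j}; card I \<le> t; j < j'; j' < (z + 1) * W\<rbrakk> \<Longrightarrow>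
      \<bar>real (card {b\<in>V. \<forall>i\<in>I. D i j b \<and> D i j' b}) - c (card I)\<bar> \<le> \<theta> * real (card V)"
  shows "\<exists>a. strict_mono_on {..<t} a \<and> a ` {..<t} \<subseteq> {..<(z + 1) * W} \<and>
    \<kappa> / (4 * real N ^ t) * real (card V) \<le> real (card (pattern_hits V D t L a))"
proof -
  define n where "n = real (card V)"
  have n: "n > 0" using V by (simp add: n_def card_gt_0_iff)
  have \<kappa>: "\<kappa> > 0" using \<open>\<delta> > 0\<close> by (simp add: \<kappa>_def)
  define blk where "blk e = (\<lambda>u. e * W + 1 + u) ` {..<N}" for e
  have blk: "finite (blk e)" "card (blk e) = N" for e
    by (auto simp: blk_def card_image inj_on_def)
  have blk_bounds: "e * W < j \<and> j < (e + 1) * W" if "j \<in> blk e" for e j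
    using that by (auto simp: blk_def W_def)
  have lt_block: "e' * W < j \<and> j < (z + 1) * W" if "j \<in> blk e" "e' \<le> e" "e \<le> z" for e e' j
    using blk_bounds[OF that(1)] mult_le_mono1[OF that(2), of W] mult_le_mono1[of "e + 1" "z + 1" W] that(3)
    by linarith
  \<comment> \<open>The rows are the points \<open>e * W\<close> with \<open>e < z\<close>, the
    columns are the last block. Every row precedes every column, so the density hypothesis covers
    all these pairs.\<close>
  obtain e where e: "strict_mono_on {..<t} e" "e ` {..<t} \<subseteq> {..<z}"
    and e_dense: "\<kappa> * real N * n \<le> (\<Sum>b\<in>V. real (card {j\<in>blk z. \<forall>i<t. D (e i * W) j b}))"
  proof -
    have "\<exists>e. strict_mono_on {..<t} e \<and> e ` {..<t} \<subseteq> {..<z} \<and>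
       \<delta> / 2 ^ (z + 1) * real (card (blk z)) * real (card V)
      \<le> (\<Sum>b\<in>V. real (card {j\<in>blk z. \<forall>i<t. D (e i * W) j b}))"
    proof (rule dense_columns_common_rows)
      show "blk z \<noteq> {}" using \<open>N > 0\<close> by (auto simp: blk_def)
      show "\<delta> * real (card V) \<le> real (card {b\<in>V. D (e * W) j b})" if "e < z" "j \<in> blk z" for e j
        using that lt_block[of j z e] by (intro dens) auto
    qed (use V blk \<open>\<delta> > 0\<close> \<open>z > 0\<close> tz in auto)
    then show ?thesis using that by (auto simp: \<kappa>_def n_def blk)
  qed
  have e_lt: "e i < z" if "i < t" for i using e that by auto
  have e_mono: "e i < e j" if "i < j" "j < t" for i j using e that by (auto simp: strict_mono_on_def)
  \<comment> \<open>\<open>I r\<close> holds the chosen points before the \<open>r\<close>-th that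
    belong to \<open>L\<close>, and \<open>f r j b\<close> says that \<open>j\<close> is joined to
    all of them in the link of \<open>b\<close>. The correlation of \<open>f r j\<close> and
    \<open>f r j'\<close> is the quantity that \<open>hom\<close> controls.\<close>
  define I where "I r = (\<lambda>i. e i * W) ` {i\<in>L. i < r}" for r
  define f where "f r j b = (of_bool (\<forall>i\<in>I r. D i j b) :: real)" for r j b
  define u where "u b = real (card {j\<in>blk z. \<forall>i<t. D (e i * W) j b})" for b
  have u_le: "u b \<le> (\<Sum>j\<in>blk z. f r j b)" if "r < t" for r b
  proof -
    have "u b = (\<Sum>j\<in>blk z. of_bool (\<forall>i<t. D (e i * W) j b))"
      using blk by (simp add: u_def Int_def of_bool_def sum.If_cases)
    also have "\<dots> \<le> (\<Sum>j\<in>blk z. f r j b)"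
      using that by (intro sum_mono) (auto simp: f_def I_def of_bool_def)
    finally show ?thesis .
  qed
  have u_N: "u b \<le> N" for b
    using card_mono[OF blk(1), of "{j\<in>blk z. \<forall>i<t. D (e i * W) j b}"] blk(2)[of z] by (auto simp: u_def)
  \<comment> \<open>A \<open>b\<close> is bad if exchanging the last block for the block after point
    \<open>e r\<close> changes the count by half of the average \<open>\<kappa> * N\<close> that
    \<open>u\<close> is known to have. By \<open>small\<close>, all bad \<open>b\<close> together
    are at most half as many as the rich ones are known to be.\<close>
  define Bad where "Bad r = {b\<in>V. (\<kappa> * N / 2)\<^sup>2 \<le> ((\<Sum>j\<in>blk (e r). f r j b) - (\<Sum>j\<in>blk z. f r j b))\<^sup>2}" for r
  define Rich where "Rich = {b\<in>V. \<kappa> * N / 2 \<le> u b}"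
  have Bad: "real (card (Bad r)) * real t \<le> \<kappa> / 4 * n" if r: "r < t" for r
  proof -
    have "e r < z" using e_lt r .
    have disj: "blk (e r) \<inter> blk z = {}"
    proof -
      have "(e r + 1) * W \<le> z * W" using \<open>e r < z\<close> by (intro mult_le_mono1) simp
      then show ?thesis by (meson blk_bounds disjoint_iff le_less_trans less_asym less_le_trans)
    qed
    have cardI: "card (I r) \<le> t"
    proof -
      have "card (I r) \<le> card {i\<in>L. i < r}" unfolding I_def by (intro card_image_le) simp
      also have "\<dots> \<le> card {..<r}" by (intro card_mono) auto
      finally show ?thesis using r by simp
    qed
    have I_sub: "I r \<subseteq> {..<j}" if "j \<in> blk (e r) \<union> blk z" for j
    proof
      fix x assume "x \<in> I r"
      then obtain i where i: "i < r" "x = e i * W" by (auto simp: I_def)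
      then have "e i \<le> e r" "e i \<le> z" using e_mono[of i r] e_lt[of i] r by auto
      then show "x \<in> {..<j}" using that i lt_block[of j _ "e i"] \<open>e r < z\<close> by auto
    qed
    have cor: "\<bar>(\<Sum>b\<in>V. f r j b * f r j' b) - c (card (I r))\<bar> \<le> \<theta> * n"
      if "j \<in> blk (e r) \<union> blk z" "j' \<in> blk (e r) \<union> blk z" "j < j'" for j j'
    proof -
      have "(\<Sum>b\<in>V. f r j b * f r j' b) = (\<Sum>b\<in>V. of_bool (\<forall>i\<in>I r. D i j b \<and> D i j' b))"
        by (intro sum.cong) (auto simp: f_def)
      also have "\<dots> = real (card {b\<in>V. \<forall>i\<in>I r. D i j b \<and> D i j' b})"
        using V by (simp add: Int_def of_bool_def sum.If_cases)
      moreover have "j' < (z + 1) * W"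
        using that(2) lt_block[of j' "e r" 0] lt_block[of j' z 0] \<open>e r < z\<close> by auto
      ultimately show ?thesis
        using hom[OF I_sub[OF that(1)] cardI that(3)] by (simp add: n_def)
    qed
    have "(\<kappa> * N / 2)\<^sup>2 * real (card (Bad r)) = (\<Sum>b\<in>Bad r. (\<kappa> * N / 2)\<^sup>2)" by simp
    also have "\<dots> \<le> (\<Sum>b\<in>Bad r. ((\<Sum>j\<in>blk (e r). f r j b) - (\<Sum>j\<in>blk z. f r j b))\<^sup>2)"
      by (intro sum_mono) (simp add: Bad_def)
    also have "\<dots> \<le> (\<Sum>b\<in>V. ((\<Sum>j\<in>blk (e r). f r j b) - (\<Sum>j\<in>blk z. f r j b))\<^sup>2)"
      using V by (intro sum_mono2) (auto simp: Bad_def)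
    also have "\<dots> \<le> 4 * real N ^ 2 * (\<theta> * n) + 2 * real N * real (card V)"
    proof (rule block_difference_second_moment[where c = "c (card (I r))"])
      fix j j' assume j: "j \<in> blk (e r) \<union> blk z" "j' \<in> blk (e r) \<union> blk z" "j \<noteq> j'"
      then show "\<bar>(\<Sum>b\<in>V. f r j b * f r j' b) - c (card (I r))\<bar> \<le> \<theta> * n"
        using cor[of j j'] cor[of j' j] by (cases "j < j'") (auto simp: mult.commute)
    qed (use V blk disj c cardI \<open>\<theta> \<ge> 0\<close> n in \<open>auto simp: f_def\<close>)
    also have "\<dots> = real N ^ 2 * n * (4 * \<theta> + 2 / real N)"
      using \<open>N > 0\<close> by (simp add: n_def field_simps power2_eq_square)
    finally have "real N ^ 2 * (\<kappa>\<^sup>2 / 4 * real (card (Bad r))) \<le> real N ^ 2 * (n * (4 * \<theta> + 2 / real N))"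
      by (simp only: power_mult_distrib power_divide) (simp add: mult_ac)
    then have "\<kappa>\<^sup>2 / 4 * real (card (Bad r)) \<le> n * (4 * \<theta> + 2 / real N)"
      using \<open>N > 0\<close> by (simp del: times_divide_eq_left)
    then have "real (card (Bad r)) \<le> 4 / \<kappa>\<^sup>2 * (4 * \<theta> + 2 / real N) * n"
      using \<kappa> by (simp add: field_simps)
    then have "real (card (Bad r)) * real t \<le> (4 / \<kappa>\<^sup>2 * (4 * \<theta> + 2 / real N) * n) * real t"
      by (intro mult_right_mono) auto
    also have "\<dots> = (4 / \<kappa>\<^sup>2 * (4 * \<theta> + 2 / real N) * real t) * n"
      by (simp only: mult_ac)
    also have "\<dots> \<le> \<kappa> / 4 * n" using small n by (intro mult_right_mono) auto
    finally show ?thesis .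
  qed
  have Bads: "real (card (\<Union>r<t. Bad r)) \<le> \<kappa> / 4 * n"
  proof (cases "t = 0")
    case False
    have "real (card (\<Union>r<t. Bad r)) \<le> (\<Sum>r<t. real (card (Bad r)))"
      by (metis card_UN_le finite_lessThan of_nat_le_iff of_nat_sum)
    also have "\<dots> \<le> (\<Sum>r<t. \<kappa> / 4 * n / real t)"
      using Bad False by (intro sum_mono, subst pos_le_divide_eq) auto
    finally show ?thesis using False by simp
  qed (use \<kappa> n in simp)
  have "\<kappa> * N * n \<le> (\<Sum>b\<in>V. u b)" using e_dense by (simp add: u_def)
  also have "\<dots> \<le> (\<Sum>b\<in>V. \<kappa> * N / 2 + (if b \<in> Rich then real N else 0))"
    using u_N \<kappa> by (intro sum_mono) (auto simp: Rich_def intro: add_increasing)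
  also have "\<dots> = real N * (\<kappa> / 2 * n + card Rich)"
    using V by (simp add: sum.distrib sum.If_cases Int_def Rich_def n_def algebra_simps)
  finally have "real N * (\<kappa> * n) \<le> real N * (\<kappa> / 2 * n + card Rich)" by (simp add: mult_ac)
  then have Rich: "\<kappa> / 2 * n \<le> card Rich" using \<open>N > 0\<close> by simp
  \<comment> \<open>\<open>w\<close> chooses one position in each block. A rich \<open>b\<close>
    that is never bad admits some choice, and fixing the best of the \<open>N ^ t\<close> choices
    causes the loss of \<open>N ^ t\<close> in the bound.\<close>
  define G where "G w = {b\<in>V. \<forall>r<t. f r (e r * W + 1 + w r) b = 1}" for w :: "nat \<Rightarrow> nat"
  define Ws where "Ws = {..<t} \<rightarrow>\<^sub>E {..<N}"
  have finW: "finite Ws" "card Ws = N ^ t" by (auto simp: Ws_def finite_PiE card_PiE)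
  have sub: "Rich - (\<Union>r<t. Bad r) \<subseteq> (\<Union>w\<in>Ws. G w)"
  proof
    fix b assume b: "b \<in> Rich - (\<Union>r<t. Bad r)"
    have "\<exists>w<N. f r (e r * W + 1 + w) b = 1" if r: "r < t" for r
    proof (rule ccontr)
      assume none: "\<not> ?thesis"
      then have "(\<Sum>j\<in>blk (e r). f r j b) = 0"
        by (intro sum.neutral) (auto simp: blk_def f_def)
      moreover have "\<kappa> * N / 2 \<le> (\<Sum>j\<in>blk z. f r j b)"
        using b u_le[OF r, of b] by (auto simp: Rich_def)
      ultimately have "b \<in> Bad r"
        using b \<kappa> by (auto simp: Bad_def Rich_def intro: power_mono)
      then show False using b r by auto
    qed
    then obtain w where w: "\<And>r. r < t \<Longrightarrow> w r < N \<and> f r (e r * W + 1 + w r) b = 1" by metis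
    have "restrict w {..<t} \<in> Ws" using w by (auto simp: Ws_def)
    moreover have "b \<in> G (restrict w {..<t})" using w b by (auto simp: G_def Rich_def)
    ultimately show "b \<in> (\<Union>w\<in>Ws. G w)" by blast
  qed
  have finG: "finite (G w)" for w using V by (simp add: G_def)
  have "card Rich \<le> card ((Rich - (\<Union>r<t. Bad r)) \<union> (\<Union>r<t. Bad r))"
    using V by (intro card_mono) (auto simp: Rich_def Bad_def)
  also have "\<dots> \<le> card (Rich - (\<Union>r<t. Bad r)) + card (\<Union>r<t. Bad r)" by (rule card_Un_le)
  finally have "\<kappa> / 4 * n \<le> card (Rich - (\<Union>r<t. Bad r))" using Rich Bads by linarith
  also have "\<dots> \<le> card (\<Union>w\<in>Ws. G w)"
    using sub finW finG by (simp add: card_mono)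
  also have "\<dots> \<le> (\<Sum>w\<in>Ws. real (card (G w)))"
    by (metis card_UN_le finW(1) of_nat_le_iff of_nat_sum)
  finally have "\<kappa> / 4 * n \<le> (\<Sum>w\<in>Ws. real (card (G w)))" .
  then obtain w where w: "w \<in> Ws" "\<kappa> / 4 * n / real (N ^ t) \<le> real (card (G w))"
    using pigeonhole_sum[OF finW(1), of "real (N ^ t)" "\<kappa> / 4 * n"] finW(2) \<kappa> n by auto
  define a where "a r = (if r \<in> L then e r * W else e r * W + 1 + w r)" for r
  have wN: "w r < N" if "r < t" for r using w that by (auto simp: Ws_def)
  have "strict_mono_on {..<t} a"
  proof (rule strict_mono_onI)
    fix r s assume rs: "r \<in> {..<t}" "s \<in> {..<t}" "r < s"
    have "a r < (e r + 1) * W" using wN[of r] rs by (auto simp: a_def W_def)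
    also have "\<dots> \<le> e s * W" using e_mono[of r s] rs by (intro mult_le_mono1) auto
    also have "\<dots> \<le> a s" by (auto simp: a_def)
    finally show "a r < a s" .
  qed
  moreover have "a r < (z + 1) * W" if "r < t" for r
  proof -
    have "a r < (e r + 1) * W" using wN[of r] that by (auto simp: a_def W_def)
    also have "\<dots> \<le> (z + 1) * W" using e_lt[of r] that by (intro mult_le_mono1) auto
    finally show ?thesis .
  qed
  moreover have "G w \<subseteq> pattern_hits V D t L a"
  proof
    fix b assume b: "b \<in> G w"
    have "D (a i) (a j) b" if "j < t" "i < j" "i \<in> L" "j \<notin> L" for i j
    proof -
      have "e i * W \<in> I j" using that by (auto simp: I_def)
      moreover have "\<forall>x\<in>I j. D x (e j * W + 1 + w j) b"
        using b that by (simp add: G_def f_def)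
      ultimately show ?thesis using that by (simp add: a_def)
    qed
    then show "b \<in> pattern_hits V D t L a" using b by (auto simp: pattern_hits_def G_def)
  qed
  then have "card (G w) \<le> card (pattern_hits V D t L a)"
    using V by (intro card_mono) (auto simp: pattern_hits_def)
  then have "\<kappa> / (4 * real N ^ t) * real (card V) \<le> card (pattern_hits V D t L a)"
    using w by (simp add: n_def)
  ultimately show ?thesis by (intro exI[of _ a]) auto
qed

lemma pattern_hits_cong:
  assumes "\<And>i j b. \<lbrakk>i < j; j < t\<rbrakk> \<Longrightarrow> D (a i) (a j) b = D' (a' i) (a' j) b"
  shows "pattern_hits V D t L a = pattern_hits V D' t L a'"
  using assms unfolding pattern_hits_def by blast

text \<open>\<open>homogeneous_pattern\<close> gives each \<open>L\<close> indices of its own. To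
  serve all \<open>L\<close> with one sequence, the Ramsey colour of a list also records for which
  \<open>L\<close> its first \<open>t\<close> entries have many hits. On a homogeneous set this
  record is constant, so an \<open>L\<close> realised once is realised by every list.\<close>

lemma simultaneous_patterns:
  fixes t :: nat and \<delta> :: real
  assumes "\<delta> > 0"
  shows "\<exists>M \<kappa>. \<kappa> > 0 \<and> (\<forall>(V::'a set) C. finite V \<and> V \<noteq> {} \<and>
      (\<forall>j<M. \<forall>i<j. \<delta> * real (card V) \<le> real (card {b\<in>V. C i j b})) \<longrightarrow>
      (\<exists>a. strict_mono_on {..<t} a \<and> a ` {..<t} \<subseteq> {..<M::nat} \<and>
        (\<forall>L\<subseteq>{..<t}. \<kappa> * real (card V) \<le> real (card (pattern_hits V C t L a)))))"
proof -
  define z where "z = nat \<lceil>2 * real t / \<delta>\<rceil> + 1"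
  define \<kappa>0 where "\<kappa>0 = \<delta> / 2 ^ (z + 1)"
  have \<kappa>0: "\<kappa>0 > 0" using assms by (simp add: \<kappa>0_def)
  \<comment> \<open>\<open>y\<close> is the budget behind \<open>small\<close>:
    \<open>4 * \<theta>\<close> and \<open>2 / N\<close> are at most \<open>y / 32\<close> each, and
    \<open>4 / \<kappa>0\<^sup>2 * (y / 16) * t\<close> is at most
    \<open>\<kappa>0 / 4\<close>.\<close>
  define y where "y = \<kappa>0 ^ 3 / (real t + 1)"
  define \<theta> where "\<theta> = y / 128"
  have \<theta>: "\<theta> > 0" using \<kappa>0 by (simp add: \<theta>_def y_def)
  define N where "N = nat \<lceil>64 * (real t + 1) / \<kappa>0 ^ 3\<rceil> + 1"
  define Q where "Q = nat \<lceil>1 / \<theta>\<rceil> + 1"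
  define \<kappa> where "\<kappa> = \<kappa>0 / (4 * real N ^ t)"
  have "N > 0" "z > 0" "Q > 0" by (auto simp: N_def z_def Q_def)
  have "\<kappa> > 0" using \<kappa>0 \<open>N > 0\<close> by (simp add: \<kappa>_def)
  have tz: "2 * real t \<le> \<delta> * real z"
  proof -
    have "2 * real t / \<delta> \<le> real z" unfolding z_def by linarith
    then show ?thesis using assms by (simp add: pos_divide_le_eq mult.commute)
  qed
  have Q\<theta>: "1 / real Q \<le> \<theta>"
  proof -
    have "1 / \<theta> \<le> real Q" unfolding Q_def by linarith
    then show ?thesis using \<theta> \<open>Q > 0\<close> by (simp add: field_simps)
  qed
  have small: "4 / \<kappa>0\<^sup>2 * (4 * \<theta> + 2 / real N) * real t \<le> \<kappa>0 / 4"
  proof -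
    have "64 * (real t + 1) / \<kappa>0 ^ 3 \<le> real N" unfolding N_def by linarith
    then have "64 * (real t + 1) \<le> real N * \<kappa>0 ^ 3" using \<kappa>0 by (simp add: pos_divide_le_eq)
    then have "2 / real N \<le> y / 32"
      using \<open>N > 0\<close> by (simp add: y_def field_simps)
    then have "4 * \<theta> + 2 / real N \<le> y / 16" by (simp add: \<theta>_def)
    then have "4 / \<kappa>0\<^sup>2 * (4 * \<theta> + 2 / real N) * real t \<le> 4 / \<kappa>0\<^sup>2 * (y / 16) * real t"
      by (intro mult_right_mono mult_left_mono) auto
    also have "\<dots> = \<kappa>0 / 4 * (real t / (real t + 1))"
      using \<kappa>0 by (simp add: y_def power2_eq_square power3_eq_cube divide_simps)
    also have "\<dots> \<le> \<kappa>0 / 4 * 1" using \<kappa>0 by (intro mult_left_mono) auto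
    finally show ?thesis by simp
  qed
  define m where "m = (z + 1) * (N + 1)"
  \<comment> \<open>The first component records the sets \<open>L\<close> with many hits, the second
    the joint densities rounded to multiples of \<open>1 / Q\<close>, which is an error of at most
    \<theta>. Lists have \<open>t + 2\<close> entries to hold up to \<open>t\<close> points and two
    common right ends.\<close>
  define cols where "cols = Pow (Pow {..<t}) \<times> ({..t} \<rightarrow>\<^sub>E {..Q})"
  have "finite cols" by (auto simp: cols_def finite_PiE)
  then obtain M where M: "\<And>\<chi> :: nat list \<Rightarrow> nat set set \<times> (nat \<Rightarrow> nat). range \<chi> \<subseteq> cols \<Longrightarrow>
    (\<exists>h. strict_mono_on {..<m + t + 2} h \<and> h ` {..<m + t + 2} \<subseteq> {..<M} \<and>
      (\<exists>c. \<forall>xs. sorted_wrt (<) xs \<and> length xs = t + 2 \<and> set xs \<subseteq> {..<m + t + 2} \<longrightarrow> \<chi> (map h xs) = c))"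
    using Ramsey_increasing_lists[of cols "m + t + 2" "t + 2"] by metis
  show ?thesis
  proof (intro exI[of _ M] exI[of _ \<kappa>] conjI allI impI)
    fix V :: "'a set" and C
    assume "finite V \<and> V \<noteq> {} \<and> (\<forall>j<M. \<forall>i<j. \<delta> * real (card V) \<le> real (card {b\<in>V. C i j b}))"
    then have V: "finite V" "V \<noteq> {}"
      and dens: "\<And>i j. \<lbrakk>i < j; j < M\<rbrakk> \<Longrightarrow> \<delta> * real (card V) \<le> real (card {b\<in>V. C i j b})" by auto
    define n where "n = real (card V)"
    have n: "n > 0" using V by (simp add: n_def card_gt_0_iff)
    define w where "w xs q = real (card {b\<in>V. \<forall>i<q. C (xs ! i) (xs ! q) b \<and> C (xs ! i) (xs ! (q + 1)) b})" for xs q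
    define \<chi> where "\<chi> xs = ({L\<in>Pow {..<t}. \<kappa> * n \<le> real (card (pattern_hits V C t L (\<lambda>i. xs ! i)))},
        \<lambda>q\<in>{..t}. nat \<lfloor>real Q * w xs q / n\<rfloor>)" for xs
    have w: "0 \<le> w xs q" "w xs q \<le> n" for xs q
      using V unfolding w_def n_def by (auto intro: card_mono)
    have "\<chi> xs \<in> cols" for xs
    proof -
      have le0: "real Q * w xs q / n \<le> real Q" for q
        using w[of xs q] n by (simp add: pos_divide_le_eq mult_left_mono)
      have le: "\<lfloor>real Q * w xs q / n\<rfloor> \<le> int Q" for q
        using le0[of q] by linarith
      have "(\<lambda>q\<in>{..t}. nat \<lfloor>real Q * w xs q / n\<rfloor>) \<in> {..t} \<rightarrow>\<^sub>E {..Q}"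
        using le by (intro restrict_PiE_iff[THEN iffD2] ballI) (simp add: nat_le_iff)
      then show ?thesis by (auto simp: \<chi>_def cols_def simp del: restrict_PiE_iff)
    qed
    then have range: "range \<chi> \<subseteq> cols" by blast
    obtain h c where h: "strict_mono_on {..<m + t + 2} h" "h ` {..<m + t + 2} \<subseteq> {..<M}"
      and "\<forall>xs. sorted_wrt (<) xs \<and> length xs = t + 2 \<and> set xs \<subseteq> {..<m + t + 2} \<longrightarrow> \<chi> (map h xs) = c"
      using M[OF range] by (elim exE conjE) (rule that)
    then have c: "\<And>xs. \<lbrakk>sorted_wrt (<) xs; length xs = t + 2; set xs \<subseteq> {..<m + t + 2}\<rbrakk> \<Longrightarrow> \<chi> (map h xs) = c"
      by simp
    define D where "D i j = C (h i) (h j)" for i j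
    have c0: "\<chi> (map h [0..<t + 2]) = c" by (intro c) (auto simp del: upt_Suc add_2_eq_Suc')
    then have c_cols: "c \<in> cols" using range by blast
    define cc where "cc q = n * real (snd c q) / real Q" for q
    have cc: "0 \<le> cc q \<and> cc q \<le> real (card V)" if "q \<le> t" for q
    proof -
      have "snd c q \<le> Q" using c_cols that by (auto simp: cols_def)
      then have "n * real (snd c q) \<le> n * real Q" using n by (intro mult_left_mono) auto
      then show ?thesis using n \<open>Q > 0\<close> by (simp add: cc_def n_def[symmetric] pos_divide_le_eq)
    qed
    have hom: "\<bar>real (card {b\<in>V. \<forall>i\<in>I. D i j b \<and> D i j' b}) - cc (card I)\<bar> \<le> \<theta> * real (card V)"
      if I: "I \<subseteq> {..<j}" "card I \<le> t" "j < j'" "j' < m" for I j j'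
    proof -
      define q where "q = card I"
      have finI: "finite I" using I finite_subset by blast
      define ys where "ys = sorted_list_of_set I"
      have ys: "length ys = q" "set ys = I" "sorted_wrt (<) ys"
        using finI by (auto simp: ys_def q_def)
      \<comment> \<open>The spare indices from \<open>m\<close> on pad the list to length
        \<open>t + 2\<close>; \<open>w\<close> at \<open>q\<close> reads only the first
        \<open>q + 2\<close> entries.\<close>
      define xs where "xs = ys @ [j, j'] @ [m..<m + (t - q)]"
      have "sorted_wrt (<) xs" using ys I by (auto simp: xs_def sorted_wrt_append)
      moreover have "length xs = t + 2" using ys I by (simp add: xs_def q_def)
      moreover have "set xs \<subseteq> {..<m + t + 2}" using ys I by (auto simp: xs_def)
      ultimately have "\<chi> (map h xs) = c" by (rule c)
      then have "snd c q = nat \<lfloor>real Q * w (map h xs) q / n\<rfloor>" using I by (auto simp: \<chi>_def q_def)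
      moreover have "w (map h xs) q = real (card {b\<in>V. \<forall>i\<in>I. D i j b \<and> D i j' b})"
      proof -
        have 1: "map h xs ! i = h (ys ! i)" if "i < q" for i
          using that ys by (simp add: xs_def nth_append)
        have 2: "map h xs ! q = h j" "map h xs ! (q + 1) = h j'"
          using ys by (simp_all add: xs_def nth_append)
        have "(\<forall>i<q. C (map h xs ! i) (h j) b \<and> C (map h xs ! i) (h j') b) \<longleftrightarrow>
            (\<forall>i\<in>I. D i j b \<and> D i j' b)" for b
          unfolding D_def using 1 ys by (metis in_set_conv_nth)
        then show ?thesis unfolding w_def 2 by simp
      qed
      moreover define x where "x = real Q * w (map h xs) q / n"
      moreover have "0 \<le> x" unfolding x_def using w n by simp
      then have "\<bar>x - real (nat \<lfloor>x\<rfloor>)\<bar> \<le> 1" by linarith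
      then have "n / real Q * \<bar>x - real (nat \<lfloor>x\<rfloor>)\<bar> \<le> n / real Q * 1"
        using n by (intro mult_left_mono) auto
      then have "\<bar>n / real Q * x - n / real Q * real (nat \<lfloor>x\<rfloor>)\<bar> \<le> n / real Q"
        unfolding right_diff_distrib[symmetric] abs_mult using n by simp
      moreover have "n / real Q * x = w (map h xs) q" using n \<open>Q > 0\<close> by (simp add: x_def)
      moreover have "n / real Q \<le> \<theta> * n" using mult_right_mono[OF Q\<theta>, of n] n by simp
      ultimately show ?thesis by (simp add: cc_def q_def n_def)
    qed
    have all: "L \<in> fst c" if L: "L \<subseteq> {..<t}" for L
    proof -
      have "\<exists>a. strict_mono_on {..<t} a \<and> a ` {..<t} \<subseteq> {..<(z + 1) * (N + 1)} \<and>
          \<delta> / 2 ^ (z + 1) / (4 * real N ^ t) * real (card V) \<le> real (card (pattern_hits V D t L a))"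
      proof (rule homogeneous_pattern[where \<theta> = \<theta> and c = cc])
        show "\<delta> * real (card V) \<le> real (card {b\<in>V. D i j b})" if "i < j" "j < (z + 1) * (N + 1)" for i j
          unfolding D_def
        proof (rule dens)
          have ij: "i \<in> {..<m + t + 2}" "j \<in> {..<m + t + 2}" using that by (auto simp: m_def)
          then show "h i < h j" using h(1) that by (auto simp: strict_mono_on_def)
          show "h j < M" using h(2) ij by blast
        qed
        show "4 / (\<delta> / 2 ^ (z + 1))\<^sup>2 * (4 * \<theta> + 2 / real N) * real t \<le> \<delta> / 2 ^ (z + 1) / 4"
          using small unfolding \<kappa>0_def .
      qed (use V assms \<open>z > 0\<close> \<open>N > 0\<close> \<theta> tz cc hom in \<open>auto simp: m_def\<close>)
      then obtain a where a: "strict_mono_on {..<t} a" "a ` {..<t} \<subseteq> {..<m}"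
        "\<kappa> * n \<le> real (card (pattern_hits V D t L a))"
        unfolding m_def \<kappa>_def \<kappa>0_def n_def by blast
      define xs where "xs = map a [0..<t] @ [m, m + 1]"
      have "sorted_wrt (<) (map a [0..<t])"
        using a(1) by (auto simp: sorted_wrt_iff_nth_less strict_mono_on_def)
      then have "sorted_wrt (<) xs" using a(2) by (fastforce simp: xs_def sorted_wrt_append)
      moreover have "set xs \<subseteq> {..<m + t + 2}" using a(2) by (fastforce simp: xs_def)
      ultimately have "\<chi> (map h xs) = c" by (intro c) (auto simp: xs_def)
      moreover have "map h xs ! i = h (a i)" if "i < t" for i
        using that by (simp add: xs_def nth_append)
      then have "pattern_hits V C t L (\<lambda>i. map h xs ! i) = pattern_hits V D t L a"
        by (intro pattern_hits_cong) (auto simp: D_def)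
      ultimately show ?thesis using a(3) L by (auto simp: \<chi>_def)
    qed
    show "\<exists>a. strict_mono_on {..<t} a \<and> a ` {..<t} \<subseteq> {..<M} \<and>
        (\<forall>L\<subseteq>{..<t}. \<kappa> * real (card V) \<le> real (card (pattern_hits V C t L a)))"
    proof (intro exI[of _ h] conjI allI impI)
      show "strict_mono_on {..<t} h" using h(1) by (auto simp: strict_mono_on_def)
      show "h ` {..<t} \<subseteq> {..<M}" by (rule order_trans[OF _ h(2)], rule image_mono) auto
      fix L assume "L \<subseteq> {..<t}"
      then have "L \<in> fst (\<chi> (map h [0..<t + 2]))" using all c0 by simp
      moreover have "pattern_hits V C t L (\<lambda>i. map h [0..<t + 2] ! i) = pattern_hits V C t L h"
        by (intro pattern_hits_cong) (simp del: upt_Suc)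
      ultimately show "\<kappa> * real (card V) \<le> real (card (pattern_hits V C t L h))"
        by (simp add: \<chi>_def n_def del: upt_Suc)
    qed
  qed (fact \<open>\<kappa> > 0\<close>)
qed

subsection \<open>Cliques of large relative codegree\<close>

text \<open>While some vertex has too many neighbours, passing to its neighbourhood lowers the
  excluded clique size by one and costs a factor \<rho>. This must stop before size 0, since the
  empty set is a clique.\<close>

lemma clique_or_sparse_subset:
  fixes R :: "'a \<Rightarrow> 'a \<Rightarrow> bool" and \<rho> :: real
  assumes "finite U" "0 < \<rho>" "\<rho> \<le> 1" and sym: "\<And>v x. R v x \<Longrightarrow> R x v" and irr: "\<And>v. \<not> R v v"
    and noclique: "\<not> (\<exists>S\<subseteq>U. card S = m \<and> (\<forall>v\<in>S. \<forall>x\<in>S. v \<noteq> x \<longrightarrow> R v x))"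
  shows "\<exists>U'\<subseteq>U. \<rho> ^ m * real (card U) \<le> real (card U') \<and>
    (\<forall>v\<in>U'. real (card {x\<in>U'. R v x}) \<le> \<rho> * real (card U'))"
  using assms(1) noclique
proof (induction m arbitrary: U)
  case 0
  then show ?case by (metis card.empty empty_iff empty_subsetI)
next
  case (Suc m)
  show ?case
  proof (cases "\<forall>v\<in>U. real (card {x\<in>U. R v x}) \<le> \<rho> * real (card U)")
    case True
    have "\<rho> ^ Suc m * real (card U) \<le> 1 * real (card U)"
      using assms(2,3) by (intro mult_right_mono power_le_one) auto
    with True show ?thesis by auto
  next
    case False
    then obtain v where v: "v \<in> U" "\<rho> * real (card U) < real (card {x\<in>U. R v x})" by force
    define U1 where "U1 = {x\<in>U. R v x}"
    have "\<not> (\<exists>S\<subseteq>U1. card S = m \<and> (\<forall>v\<in>S. \<forall>x\<in>S. v \<noteq> x \<longrightarrow> R v x))"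
    proof
      assume "\<exists>S\<subseteq>U1. card S = m \<and> (\<forall>v\<in>S. \<forall>x\<in>S. v \<noteq> x \<longrightarrow> R v x)"
      then obtain S where S: "S \<subseteq> U1" "card S = m" "\<forall>v\<in>S. \<forall>x\<in>S. v \<noteq> x \<longrightarrow> R v x" by blast
      have "v \<notin> S" using S irr by (auto simp: U1_def)
      moreover have "finite S" using S Suc.prems(1) by (auto simp: U1_def intro: finite_subset)
      ultimately have "card (insert v S) = Suc m" using S by simp
      moreover have "insert v S \<subseteq> U" using S v by (auto simp: U1_def)
      moreover have "\<forall>a\<in>insert v S. \<forall>x\<in>insert v S. a \<noteq> x \<longrightarrow> R a x"
        using S sym by (auto simp: U1_def)
      ultimately show False using Suc.prems(2) by blast
    qed
    then obtain U' where U': "U' \<subseteq> U1" "\<rho> ^ m * real (card U1) \<le> real (card U')"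
      "\<forall>v\<in>U'. real (card {x\<in>U'. R v x}) \<le> \<rho> * real (card U')"
      using Suc.IH[of U1] Suc.prems(1) by (auto simp: U1_def)
    have "\<rho> ^ Suc m * real (card U) \<le> \<rho> ^ m * real (card U1)"
      using mult_left_mono[of "\<rho> * real (card U)" "real (card U1)" "\<rho> ^ m"] v assms(2)
      by (simp add: U1_def mult_ac)
    then show ?thesis using U' by (intro exI[of _ U']) (auto simp: U1_def)
  qed
qed

text \<open>Elements of largest value are deleted one at a time. If that value is at least
  \<open>c\<close>, the bound on the average survives; otherwise all remaining values are below
  \<open>c\<close>.\<close>

lemma small_sum_subset:
  fixes F :: "'a \<Rightarrow> real"
  assumes "finite U" "w \<le> card U" "sum F U \<le> c * real (card U)"
  shows "\<exists>W\<subseteq>U. card W = w \<and> sum F W \<le> c * real w"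
  using assms
proof (induction "card U - w" arbitrary: U)
  case 0
  then show ?case by (intro exI[of _ U]) auto
next
  case (Suc r)
  have "U \<noteq> {}" using Suc by auto
  define m where "m = Max (F ` U)"
  have "m \<in> F ` U" unfolding m_def using Suc \<open>U \<noteq> {}\<close> by (intro Max_in) auto
  then obtain x where x: "x \<in> U" "m = F x" by auto
  have le: "F y \<le> F x" if "y \<in> U" for y using that Suc x unfolding m_def[symmetric] x(2)[symmetric]
    by (auto simp: m_def)
  have cU: "card (U - {x}) = card U - 1" "card U \<ge> 1" using x Suc by (auto simp: Suc_le_eq card_gt_0_iff)
  have split: "sum F U = F x + sum F (U - {x})" using x Suc by (simp add: sum.remove)
  have "sum F (U - {x}) \<le> c * real (card (U - {x}))"
  proof (cases "F x \<ge> c")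
    case True
    then show ?thesis using split Suc.prems cU by (simp add: of_nat_diff algebra_simps)
  next
    case False
    then have "sum F (U - {x}) \<le> (\<Sum>y\<in>U - {x}. c)" using le by (intro sum_mono) force
    then show ?thesis by (simp add: mult.commute)
  qed
  then obtain W where "W \<subseteq> U - {x}" "card W = w" "sum F W \<le> c * real w"
    using Suc.hyps(1)[of "U - {x}"] Suc.hyps(2) Suc.prems(1) cU by fastforce
  then show ?case by blast
qed

section \<open>Heavy pairs with respect to a family of sets\<close>

definition rel_codeg :: "'a set set \<Rightarrow> 'a set \<Rightarrow> 'a \<Rightarrow> 'a \<Rightarrow> nat" where
  "rel_codeg E Y v x = card {b\<in>Y. {v, x, b} \<in> E}"

text \<open>The family records the sets passed through so far. Enlarging it only creates heavy
  pairs, and the empty family has none; the induction in \<open>sparse_union\<close> rests on the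
  first fact and starts from the second.\<close>

definition heavy :: "real \<Rightarrow> 'a set set \<Rightarrow> 'a set set \<Rightarrow> 'a \<Rightarrow> 'a \<Rightarrow> bool" where
  "heavy \<delta> E \<Y> v x \<longleftrightarrow> v \<noteq> x \<and> (\<exists>Y\<in>\<Y>. \<delta> * real (card Y) \<le> real (rel_codeg E Y v x))"

lemma heavy_sym: "heavy \<delta> E \<Y> v x \<Longrightarrow> heavy \<delta> E \<Y> x v"
  by (simp add: heavy_def rel_codeg_def insert_commute) blast

text \<open>Pairs are coloured by a set that witnesses heaviness, and Ramsey's theorem leaves a
  single witness. Size \<open>M + 2\<close> ensures that the homogeneous set contains a pair at all,
  so that its colour is the code of a member of \<open>\<Y>\<close>.\<close>

lemma heavy_clique_single:
  fixes M s :: nat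
  shows "\<exists>M'. \<forall>(\<Y>::'a set set) E \<delta> S. finite \<Y> \<and> card \<Y> \<le> s \<and> finite S \<and> card S = M' \<and>
      (\<forall>v\<in>S. \<forall>x\<in>S. v \<noteq> x \<longrightarrow> heavy \<delta> E \<Y> v x) \<longrightarrow>
    (\<exists>Y\<in>\<Y>. \<exists>S'\<subseteq>S. card S' = M + 2 \<and> (\<forall>v\<in>S'. \<forall>x\<in>S'. v \<noteq> x \<longrightarrow> heavy \<delta> E {Y} v x))"
proof -
  obtain M' where M': "\<And>\<chi> :: nat list \<Rightarrow> nat. range \<chi> \<subseteq> {..s} \<Longrightarrow>
    \<exists>h. strict_mono_on {..<M + 2} h \<and> h ` {..<M + 2} \<subseteq> {..<M'} \<and>
      (\<exists>c. \<forall>xs. sorted_wrt (<) xs \<and> length xs = 2 \<and> set xs \<subseteq> {..<M + 2} \<longrightarrow> \<chi> (map h xs) = c)"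
    using Ramsey_increasing_lists[of "{..s}" "M + 2" 2] by auto
  show ?thesis
  proof (intro exI[of _ M'] allI impI, elim conjE)
    fix \<Y> :: "'a set set" and E \<delta> S
    assume \<Y>: "finite \<Y>" "card \<Y> \<le> s" and S: "finite S" "card S = M'"
      and cl: "\<forall>v\<in>S. \<forall>x\<in>S. v \<noteq> x \<longrightarrow> heavy \<delta> E \<Y> v x"
    obtain g where g: "bij_betw g {0..<M'} S" using ex_bij_betw_nat_finite[OF S(1)] S(2) by blast
    obtain enc :: "'a set \<Rightarrow> nat" where enc: "bij_betw enc \<Y> {0..<card \<Y>}"
      using ex_bij_betw_finite_nat[OF \<Y>(1)] by blast
    define P where "P xs Y \<longleftrightarrow> Y \<in> \<Y> \<and> heavy \<delta> E {Y} (g (xs ! 0)) (g (xs ! 1))" for xs Y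
    \<comment> \<open>The cap by \<open>s\<close> matters only for lists without a witness, where
      the choice is arbitrary; for genuine pairs the code is below \<open>card \<Y>\<close>
      anyway.\<close>
    define \<chi> where "\<chi> xs = min s (enc (SOME Y. P xs Y))" for xs
    have "range \<chi> \<subseteq> {..s}" by (auto simp: \<chi>_def)
    from M'[OF this] obtain h c where h: "strict_mono_on {..<M + 2} h" "h ` {..<M + 2} \<subseteq> {..<M'}"
      and c: "\<forall>xs. sorted_wrt (<) xs \<and> length xs = 2 \<and> set xs \<subseteq> {..<M + 2} \<longrightarrow> \<chi> (map h xs) = c"
      by (elim exE conjE) (rule that)
    have hM: "h i < M'" if "i < M + 2" for i using h(2) that by blast
    have ex: "\<exists>Y\<in>\<Y>. enc Y = c \<and> heavy \<delta> E {Y} (g (h i)) (g (h j))" if "i < j" "j < M + 2" for i j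
    proof -
      have "h i < h j" using h(1) that by (auto simp: strict_mono_on_def)
      moreover have ij: "h i \<in> {0..<M'}" "h j \<in> {0..<M'}" using hM[of i] hM[of j] that by auto
      ultimately have ne: "g (h i) \<noteq> g (h j)" "g (h i) \<in> S" "g (h j) \<in> S"
        using bij_betw_imp_inj_on[OF g, THEN inj_onD, OF _ ij] bij_betw_apply[OF g] by auto
      then have "heavy \<delta> E \<Y> (g (h i)) (g (h j))" using cl by blast
      then have "\<exists>Y. P (map h [i, j]) Y" by (auto simp: P_def heavy_def)
      then have P: "P (map h [i, j]) (SOME Y. P (map h [i, j]) Y)" by (rule someI_ex)
      have "\<chi> (map h [i, j]) = c"
        using c[rule_format, of "[i, j]"] that by (simp add: numeral_2_eq_2)
      moreover have "enc (SOME Y. P (map h [i, j]) Y) < card \<Y>"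
        using P enc unfolding P_def bij_betw_def by fastforce
      ultimately have "enc (SOME Y. P (map h [i, j]) Y) = c" using \<Y> unfolding \<chi>_def by linarith
      then show ?thesis using P by (auto simp: P_def)
    qed
    obtain Y where Y: "Y \<in> \<Y>" "enc Y = c" using ex[of 0 1] by auto
    have hv: "heavy \<delta> E {Y} (g (h i)) (g (h j))" if "i < j" "j < M + 2" for i j
      using ex[OF that] Y enc unfolding bij_betw_def inj_on_def by metis
    have inj: "inj_on (\<lambda>i. g (h i)) {..<M + 2}"
      using hv by (intro linorder_inj_onI) (auto simp: heavy_def)
    show "\<exists>Y\<in>\<Y>. \<exists>S'\<subseteq>S. card S' = M + 2 \<and> (\<forall>v\<in>S'. \<forall>x\<in>S'. v \<noteq> x \<longrightarrow> heavy \<delta> E {Y} v x)"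
    proof (intro bexI[of _ Y] exI[of _ "(\<lambda>i. g (h i)) ` {..<M + 2}"] conjI ballI impI)
      show "(\<lambda>i. g (h i)) ` {..<M + 2} \<subseteq> S" using g hM unfolding bij_betw_def by fastforce
      show "card ((\<lambda>i. g (h i)) ` {..<M + 2}) = M + 2" using inj by (simp add: card_image)
      fix v x assume "v \<in> (\<lambda>i. g (h i)) ` {..<M + 2}" "x \<in> (\<lambda>i. g (h i)) ` {..<M + 2}" "v \<noteq> x"
      then obtain i j where ij: "i < M + 2" "j < M + 2" "v = g (h i)" "x = g (h j)" "i \<noteq> j" by auto
      then show "heavy \<delta> E {Y} v x"
        using hv[of i j] hv[of j i] heavy_sym by (metis linorder_neqE_nat)
    qed (fact Y)
  qed
qed

lemma card_3_containing:
  assumes "card e = 3" "x \<in> e"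
  obtains v v' where "e = {v, v', x}" "v \<noteq> v'" "v \<noteq> x" "v' \<noteq> x"
proof -
  have "card (e - {x}) = 2" using assms by (simp add: card_Diff_singleton)
  then obtain v v' where "e - {x} = {v, v'}" "v \<noteq> v'" by (auto simp: card_2_iff)
  then show ?thesis using that[of v v'] assms(2) by blast
qed

section \<open>Unions of equal pieces that span too few edges\<close>

text \<open>The new piece \<open>X\<close> is found in \<open>U - W\<close> by averaging. Pairs in
  \<open>W\<close> that are light for \<open>U\<close> extend to few edges with third vertex in
  \<open>U\<close>, so an average vertex of \<open>U\<close> forms few edges with pairs of
  \<open>W\<close>; by \<open>deg\<close> it is also heavy with few vertices of \<open>W\<close>.
  Adding \<open>X\<close> therefore creates edges of order \<open>s * w ^ 3\<close> only, where a
  dense hypergraph would need order \<open>s\<^sup>2 * w ^ 3\<close>.\<close>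

lemma sparse_union_step:
  fixes V :: "'a set" and E :: "'a set set" and \<delta> \<rho> :: real and s w :: nat
  assumes H: "three_graph V E" and U: "U \<subseteq> V" "2 * (s + 1) * w \<le> card U" "w > 0"
    and W: "W \<subseteq> U" "card W = s * w"
    and \<delta>: "0 < \<delta>" "\<delta> * real s \<le> 1" and \<rho>: "0 < \<rho>" "8 * \<rho> * real s \<le> 1"
    and deg: "\<forall>v\<in>U. real (card {x\<in>U. heavy \<delta> E \<Y> v x}) \<le> \<rho> * real (card U)"
    and pairs: "card {(v, x). v \<in> W \<and> x \<in> W \<and> heavy \<delta> E (insert U \<Y>) v x} \<le> 2 * s * w\<^sup>2"
    and edges: "card {e\<in>E. e \<subseteq> W} \<le> 13 * s\<^sup>2 * w ^ 3"
  shows "\<exists>W'\<subseteq>U. card W' = (s + 1) * w \<and>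
    card {(v, x). v \<in> W' \<and> x \<in> W' \<and> heavy \<delta> E \<Y> v x} \<le> 2 * (s + 1) * w\<^sup>2 \<and>
    card {e\<in>E. e \<subseteq> W'} \<le> 13 * (s + 1)\<^sup>2 * w ^ 3"
proof -
  have fin: "finite V" "finite U" "finite W"
    using H U W by (auto simp: three_graph_def intro: finite_subset)
  have card3: "card e = 3" if "e \<in> E" for e using H that by (simp add: three_graph_def)
  define n where "n = real (card U)"
  define f where "f x = real (card {v\<in>W. heavy \<delta> E \<Y> v x})" for x
  define g where "g x = real (card {(v, v'). v \<in> W \<and> v' \<in> W \<and> {v, v', x} \<in> E})" for x
  have "sum f U = (\<Sum>x\<in>U. \<Sum>v\<in>W. of_bool (heavy \<delta> E \<Y> v x))"
    using fin by (simp add: f_def Int_def of_bool_def sum.If_cases)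
  also have "\<dots> = (\<Sum>v\<in>W. \<Sum>x\<in>U. of_bool (heavy \<delta> E \<Y> v x))" by (rule sum.swap)
  also have "\<dots> = (\<Sum>v\<in>W. real (card {x\<in>U. heavy \<delta> E \<Y> v x}))"
    using fin by (simp add: Int_def of_bool_def sum.If_cases)
  also have "\<dots> \<le> (\<Sum>v\<in>W. \<rho> * n)" using deg W(1) by (intro sum_mono) (auto simp: n_def)
  finally have sum_f: "sum f U \<le> real s * real w * \<rho> * n" using W(2) by simp
  define Hv where "Hv = {(v, x). v \<in> W \<and> x \<in> W \<and> heavy \<delta> E (insert U \<Y>) v x}"
  have finHv: "finite Hv" unfolding Hv_def by (rule finite_subset[of _ "W \<times> W"]) (use fin in auto)
  have codeg_light: "real (card {x\<in>U. {v, v', x} \<in> E}) \<le> \<delta> * n + of_bool ((v, v') \<in> Hv) * n"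
    if "v \<in> W" "v' \<in> W" for v v'
  proof (cases "(v, v') \<in> Hv")
    case True
    have "card {x\<in>U. {v, v', x} \<in> E} \<le> card U" using fin by (intro card_mono) auto
    then show ?thesis using True \<delta> by (simp add: n_def add_increasing)
  next
    case False
    show ?thesis
    proof (cases "v = v'")
      case True
      have "{v, v', x} \<notin> E" for x
        using card3[of "{v, v', x}"] card_insert_le_m1[of 2 "{x}" v] True by auto
      then show ?thesis using \<delta> False by (simp add: n_def)
    next
      case ne: False
      then show ?thesis using False that by (auto simp: Hv_def heavy_def rel_codeg_def n_def)
    qed
  qed
  have g_sum: "g x = (\<Sum>(v, v')\<in>W \<times> W. of_bool ({v, v', x} \<in> E))" for x
  proof -
    have "{(v, v'). v \<in> W \<and> v' \<in> W \<and> {v, v', x} \<in> E} = (W \<times> W) \<inter> {p. {fst p, snd p, x} \<in> E}" by auto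
    then show ?thesis using fin by (simp add: g_def of_bool_def sum.If_cases case_prod_beta)
  qed
  have "sum g U = (\<Sum>(v, v')\<in>W \<times> W. \<Sum>x\<in>U. of_bool ({v, v', x} \<in> E))"
    unfolding g_sum by (subst sum.swap) (simp add: case_prod_beta)
  also have "\<dots> = (\<Sum>(v, v')\<in>W \<times> W. real (card {x\<in>U. {v, v', x} \<in> E}))"
    using fin by (simp add: Int_def of_bool_def sum.If_cases)
  also have "\<dots> \<le> (\<Sum>(v, v')\<in>W \<times> W. \<delta> * n + of_bool ((v, v') \<in> Hv) * n)"
  proof (intro sum_mono)
    fix p assume "p \<in> W \<times> W"
    then obtain v v' where p: "p = (v, v')" "v \<in> W" "v' \<in> W" by auto
    show "(case p of (v, v') \<Rightarrow> real (card {x\<in>U. {v, v', x} \<in> E}))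
        \<le> (case p of (v, v') \<Rightarrow> \<delta> * n + of_bool ((v, v') \<in> Hv) * n)"
      using codeg_light[OF p(2,3)] unfolding p(1) prod.case .
  qed
  also have "\<dots> = real (card W) ^ 2 * (\<delta> * n) + (\<Sum>p\<in>W \<times> W. of_bool (p \<in> Hv)) * n"
    by (simp add: case_prod_beta sum.distrib power2_eq_square sum_distrib_right card_cartesian_product)
  also have "(\<Sum>p\<in>W \<times> W. of_bool (p \<in> Hv)) = real (card Hv)"
  proof -
    have "W \<times> W \<inter> Hv = Hv" by (auto simp: Hv_def)
    then show ?thesis using fin by (simp add: of_bool_def sum.If_cases)
  qed
  finally have "sum g U \<le> ((real s * real w)\<^sup>2 * \<delta> + real (card Hv)) * n"
    using W(2) by (simp add: algebra_simps)
  also have "\<dots> \<le> (3 * real s * real w ^ 2) * n"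
  proof (intro mult_right_mono)
    have "real (card Hv) \<le> real (2 * s * w\<^sup>2)" using pairs unfolding Hv_def of_nat_le_iff .
    moreover have "(\<delta> * real s) * (real s * real w ^ 2) \<le> 1 * (real s * real w ^ 2)"
      using \<delta> by (intro mult_right_mono) auto
    ultimately show "(real s * real w)\<^sup>2 * \<delta> + real (card Hv) \<le> 3 * real s * real w ^ 2"
      by (simp add: power2_eq_square algebra_simps)
  qed (simp add: n_def)
  finally have sum_g: "sum g U \<le> 3 * real s * real w ^ 2 * n" .
  \<comment> \<open>One weight controls both costs in a single averaging. The factor is chosen so
    that the resulting bound \<open>(12 * s + 6) * w ^ 3\<close> leaves at most
    \<open>w\<^sup>2 / 2\<close> heavy pairs between \<open>W\<close> and \<open>X\<close>, hence
    \<open>w\<^sup>2\<close> with both orientations; the pairs inside \<open>X\<close> account for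
    the other \<open>w\<^sup>2\<close>.\<close>
  define F where "F x = g x + 24 * (real s + 1) * real w * f x" for x
  have cUW: "n \<le> 2 * real (card (U - W))" "w \<le> card (U - W)"
  proof -
    have c: "card (U - W) = card U - s * w" using W fin by (simp add: card_Diff_subset)
    have a: "2 * (s * w) + 2 * w \<le> card U" using U by (simp add: algebra_simps)
    show "w \<le> card (U - W)" unfolding c using a by linarith
    have "card U \<le> 2 * card (U - W)" unfolding c using a by linarith
    then show "n \<le> 2 * real (card (U - W))" unfolding n_def by linarith
  qed
  have F0: "F x \<ge> 0" for x by (simp add: F_def f_def g_def)
  have "sum F (U - W) \<le> sum F U" using fin F0 by (intro sum_mono2) auto
  also have "\<dots> = sum g U + 24 * (real s + 1) * real w * sum f U"
    by (simp add: F_def sum.distrib sum_distrib_left)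
  also have "\<dots> \<le> 3 * real s * real w ^ 2 * n + 24 * (real s + 1) * real w * (real w / 8 * n)"
  proof (intro add_mono mult_left_mono)
    have "real s * real w * \<rho> * n = (8 * \<rho> * real s) * (real w / 8 * n)" by simp
    also have "\<dots> \<le> 1 * (real w / 8 * n)" using \<rho> by (intro mult_right_mono) (auto simp: n_def)
    finally show "sum f U \<le> real w / 8 * n" using sum_f by simp
  qed (use sum_g in auto)
  also have "\<dots> = ((6 * real s + 3) * real w ^ 2) * n"
    by (simp add: algebra_simps power2_eq_square)
  also have "\<dots> \<le> ((6 * real s + 3) * real w ^ 2) * (2 * real (card (U - W)))"
    using cUW(1) by (intro mult_left_mono) auto
  finally have "sum F (U - W) \<le> (12 * real s + 6) * real w ^ 2 * real (card (U - W))"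
    by (simp add: algebra_simps)
  then obtain X where X: "X \<subseteq> U - W" "card X = w"
    and sum_F: "sum F X \<le> (12 * real s + 6) * real w ^ 2 * real w"
    using small_sum_subset[of "U - W" w F] cUW(2) fin by auto
  have finX: "finite X" using X fin finite_subset by blast
  have F_split: "sum F X = sum g X + 24 * (real s + 1) * real w * sum f X"
    by (simp add: F_def sum.distrib sum_distrib_left)
  have "sum f X \<ge> 0" "sum g X \<ge> 0" by (auto simp: f_def g_def intro: sum_nonneg)
  then have sum_gX: "sum g X \<le> (12 * real s + 6) * real w ^ 3"
    using sum_F F_split by (simp add: power2_eq_square power3_eq_cube add_increasing2 mult.assoc)
      (smt (verit) mult_nonneg_nonneg of_nat_0_le_iff)
  have sum_fX: "2 * sum f X \<le> real w ^ 2"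
  proof -
    have "24 * (real s + 1) * real w * sum f X \<le> (12 * real s + 6) * real w ^ 2 * real w"
      using sum_F F_split \<open>sum g X \<ge> 0\<close> by linarith
    also have "\<dots> \<le> 12 * (real s + 1) * real w * real w ^ 2"
      by (simp add: algebra_simps power2_eq_square)
    finally have "12 * (real s + 1) * real w * (2 * sum f X) \<le> 12 * (real s + 1) * real w * real w ^ 2"
      by (simp add: mult_ac)
    then show ?thesis using U(3) by (simp add: add_pos_nonneg)
  qed
  define Q where "Q = Sigma X (\<lambda>x. {v\<in>W. heavy \<delta> E \<Y> v x})"
  have finQ: "finite Q" using finX fin by (auto simp: Q_def)
  have cQ: "real (card Q) = sum f X" using finX fin by (simp add: Q_def f_def card_SigmaI)
  show ?thesis
  proof (intro exI[of _ "W \<union> X"] conjI)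
    show "W \<union> X \<subseteq> U" using W X by auto
    show cWX: "card (W \<union> X) = (s + 1) * w"
      using W X fin finX by (subst card_Un_disjoint) auto
    have "{(v, x). v \<in> W \<union> X \<and> x \<in> W \<union> X \<and> heavy \<delta> E \<Y> v x} \<subseteq> (Hv \<union> X \<times> X) \<union> (Q \<union> prod.swap ` Q)"
    proof
      fix p assume "p \<in> {(v, x). v \<in> W \<union> X \<and> x \<in> W \<union> X \<and> heavy \<delta> E \<Y> v x}"
      then obtain v x where p: "p = (v, x)" and a: "v \<in> W \<union> X" "x \<in> W \<union> X" "heavy \<delta> E \<Y> v x" by auto
      have "heavy \<delta> E (insert U \<Y>) v x" using a(3) by (auto simp: heavy_def)
      then show "p \<in> (Hv \<union> X \<times> X) \<union> (Q \<union> prod.swap ` Q)"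
        using a heavy_sym[OF a(3)] unfolding p by (auto simp: Hv_def Q_def image_iff)
    qed
    then have "card {(v, x). v \<in> W \<union> X \<and> x \<in> W \<union> X \<and> heavy \<delta> E \<Y> v x}
        \<le> card ((Hv \<union> X \<times> X) \<union> (Q \<union> prod.swap ` Q))"
      using finHv finX finQ by (intro card_mono) auto
    also have "\<dots> \<le> (card Hv + card (X \<times> X)) + (card Q + card (prod.swap ` Q))"
      by (intro order_trans[OF card_Un_le] add_mono card_Un_le)
    also have "\<dots> \<le> (2 * s * w\<^sup>2 + w * w) + (card Q + card Q)"
      using pairs X finQ by (intro add_mono) (auto simp: Hv_def card_cartesian_product card_image_le)
    also have "\<dots> \<le> 2 * (s + 1) * w\<^sup>2"
    proof -
      have "real (2 * card Q) \<le> real (w\<^sup>2)" using sum_fX cQ by simp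
      then have "2 * card Q \<le> w\<^sup>2" unfolding of_nat_le_iff .
      then show ?thesis by (simp add: power2_eq_square algebra_simps)
    qed
    finally show "card {(v, x). v \<in> W \<union> X \<and> x \<in> W \<union> X \<and> heavy \<delta> E \<Y> v x} \<le> 2 * (s + 1) * w\<^sup>2" .
    define G where "G = Sigma X (\<lambda>x. {(v, v'). v \<in> W \<and> v' \<in> W \<and> {v, v', x} \<in> E})"
    have finG: "finite G" unfolding G_def
      by (rule finite_subset[of _ "X \<times> W \<times> W"]) (use finX fin in auto)
    have cG: "real (card G) = sum g X"
    proof -
      have "finite {(v, v'). v \<in> W \<and> v' \<in> W \<and> {v, v', x} \<in> E}" for x
        by (rule finite_subset[of _ "W \<times> W"]) (use fin in auto)
      then show ?thesis using finX by (simp add: G_def g_def card_SigmaI)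
    qed
    \<comment> \<open>An edge meeting \<open>X\<close> in \<open>x\<close> has its other two
      vertices in \<open>W\<close>, which \<open>G\<close> counts, or a second vertex in
      \<open>X\<close>, which \<open>P\<close> counts generously.\<close>
    define P where "P = X \<times> X \<times> (W \<union> X)"
    have "{e\<in>E. e \<subseteq> W \<union> X} \<subseteq> {e\<in>E. e \<subseteq> W} \<union> ((\<lambda>(x, v, v'). {v, v', x}) ` G \<union> (\<lambda>(x, y, z). {y, z, x}) ` P)"
    proof
      fix e assume e: "e \<in> {e\<in>E. e \<subseteq> W \<union> X}"
      show "e \<in> {e\<in>E. e \<subseteq> W} \<union> ((\<lambda>(x, v, v'). {v, v', x}) ` G \<union> (\<lambda>(x, y, z). {y, z, x}) ` P)"
      proof (cases "e \<subseteq> W")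
        case False
        then obtain x where x: "x \<in> e" "x \<in> X" using e by blast
        have "card e = 3" using card3 e by simp
        then obtain v v' where v: "e = {v, v', x}" by (rule card_3_containing[OF _ x(1)])
        have "v \<in> W \<union> X" "v' \<in> W \<union> X" using e v by auto
        then consider "v \<in> X" | "v' \<in> X" | "v \<in> W" "v' \<in> W" by blast
        then show ?thesis
        proof cases
          case 1
          then have "(x, v, v') \<in> P" using x e v by (auto simp: P_def)
          then have "e \<in> (\<lambda>(x, y, z). {y, z, x}) ` P" using v by (intro image_eqI) auto
          then show ?thesis by simp
        next
          case 2
          then have "(x, v', v) \<in> P" using x e v by (auto simp: P_def)
          then have "e \<in> (\<lambda>(x, y, z). {y, z, x}) ` P" using v by (intro image_eqI) auto
          then show ?thesis by simp
        next
          case 3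
          then have "(x, v, v') \<in> G" using x e v by (auto simp: G_def)
          then have "e \<in> (\<lambda>(x, v, v'). {v, v', x}) ` G" using v by (intro image_eqI) auto
          then show ?thesis by simp
        qed
      qed (use e in auto)
    qed
    then have "card {e\<in>E. e \<subseteq> W \<union> X}
        \<le> card ({e\<in>E. e \<subseteq> W} \<union> ((\<lambda>(x, v, v'). {v, v', x}) ` G \<union> (\<lambda>(x, y, z). {y, z, x}) ` P))"
      using finG fin finX by (intro card_mono) (auto simp: P_def)
    also have "\<dots> \<le> card {e\<in>E. e \<subseteq> W} + (card ((\<lambda>(x, v, v'). {v, v', x}) ` G) + card ((\<lambda>(x, y, z). {y, z, x}) ` P))"
      by (intro order_trans[OF card_Un_le] add_mono card_Un_le order_refl)
    also have "\<dots> \<le> 13 * s\<^sup>2 * w ^ 3 + (card G + card P)"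
      using edges finG fin finX by (intro add_mono card_image_le) (auto simp: P_def)
    also have "card P = (s + 1) * w ^ 3"
      using X cWX by (simp add: P_def card_cartesian_product power3_eq_cube algebra_simps)
    also have "card G \<le> (12 * s + 6) * w ^ 3"
    proof -
      have "real (card G) \<le> real ((12 * s + 6) * w ^ 3)" using sum_gX cG by simp
      then show ?thesis unfolding of_nat_le_iff .
    qed
    also have "13 * s\<^sup>2 * w ^ 3 + ((12 * s + 6) * w ^ 3 + (s + 1) * w ^ 3) \<le> 13 * (s + 1)\<^sup>2 * w ^ 3"
      by (simp add: power2_eq_square algebra_simps)
    finally show "card {e\<in>E. e \<subseteq> W \<union> X} \<le> 13 * (s + 1)\<^sup>2 * w ^ 3" by simp
  qed
qed

text \<open>The sets \<open>U\<close> form a decreasing chain: each joins the family before a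
  sparser \<open>U'\<close> is chosen inside it, and \<open>W\<close> is assembled on the way back,
  from the innermost set outwards. So when a piece is taken from \<open>U\<close>, most pairs of the
  current \<open>W\<close> are already light for \<open>U\<close>. As the family never exceeds
  \<open>S\<close> members, \<open>M'\<close> and \<open>K\<close> can be fixed in advance:
  \<open>K * \<rho> ^ M'\<close> pays for the passage to \<open>U'\<close>, and \<open>K\<close>
  itself leaves room for the pieces.\<close>

lemma sparse_union:
  fixes V :: "'a set" and E :: "'a set set" and \<delta> \<rho> K :: real and S w M' :: nat
  assumes H: "three_graph V E" and "w > 0" "S > 0"
    and \<delta>: "0 < \<delta>" "\<delta> * real S \<le> 1" and \<rho>: "0 < \<rho>" "8 * \<rho> * real S \<le> 1"
    and K: "1 \<le> K * \<rho> ^ M'" "2 * (real S + 1) \<le> K"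
    and noclique: "\<And>\<Y>. \<lbrakk>finite \<Y>; card \<Y> \<le> S; \<forall>Y\<in>\<Y>. Y \<subseteq> V \<and> w \<le> card Y\<rbrakk> \<Longrightarrow>
      \<not> (\<exists>T\<subseteq>V. card T = M' \<and> (\<forall>v\<in>T. \<forall>x\<in>T. v \<noteq> x \<longrightarrow> heavy \<delta> E \<Y> v x))"
  shows "\<lbrakk>finite \<Y>; s + card \<Y> \<le> S; \<forall>Y\<in>\<Y>. Y \<subseteq> V \<and> w \<le> card Y; U \<subseteq> V;
      real w * K ^ s \<le> real (card U);
      \<forall>v\<in>U. real (card {x\<in>U. heavy \<delta> E \<Y> v x}) \<le> \<rho> * real (card U)\<rbrakk> \<Longrightarrow>
    \<exists>W\<subseteq>U. card W = s * w \<and>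
      card {(v, x). v \<in> W \<and> x \<in> W \<and> heavy \<delta> E \<Y> v x} \<le> 2 * s * w\<^sup>2 \<and>
      card {e\<in>E. e \<subseteq> W} \<le> 13 * s\<^sup>2 * w ^ 3"
proof (induction s arbitrary: \<Y> U)
  case 0
  have "{e\<in>E. e \<subseteq> {}} = {}" using H by (auto simp: three_graph_def)
  then show ?case by (intro exI[of _ "{}"]) auto
next
  case (Suc s)
  have K1: "1 \<le> K" using K(2) of_nat_0_le_iff[of S] by (simp add: algebra_simps)
  have finU: "finite U" using H Suc.prems by (auto simp: three_graph_def intro: finite_subset)
  have Kw: "K * real w \<le> real (card U)"
  proof -
    have "K * real w = real w * K ^ 1" by simp
    also have "\<dots> \<le> real w * K ^ Suc s" using K1 by (intro mult_left_mono power_increasing) auto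
    finally show ?thesis using Suc.prems by linarith
  qed
  have "real (2 * (S + 1) * w) \<le> K * real w" using mult_right_mono[OF K(2), of "real w"] by (simp add: algebra_simps)
  then have cU: "2 * (S + 1) * w \<le> card U" using Kw by linarith
  define \<Y>' where "\<Y>' = insert U \<Y>"
  have "w \<le> card U" using cU by simp
  have \<Y>': "finite \<Y>'" "s + card \<Y>' \<le> S" "\<forall>Y\<in>\<Y>'. Y \<subseteq> V \<and> w \<le> card Y"
    using Suc.prems \<open>w \<le> card U\<close> by (auto simp: \<Y>'_def card_insert_if)
  have "8 * \<rho> * 1 \<le> 8 * \<rho> * real S" using \<rho> \<open>S > 0\<close> by (intro mult_left_mono) auto
  then have "\<rho> \<le> 1" using \<rho> by linarith
  have "\<not> (\<exists>T\<subseteq>V. card T = M' \<and> (\<forall>v\<in>T. \<forall>x\<in>T. v \<noteq> x \<longrightarrow> heavy \<delta> E \<Y>' v x))"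
    using noclique[of \<Y>'] \<Y>' by simp
  then have "\<not> (\<exists>T\<subseteq>U. card T = M' \<and> (\<forall>v\<in>T. \<forall>x\<in>T. v \<noteq> x \<longrightarrow> heavy \<delta> E \<Y>' v x))"
    using Suc.prems(4) by blast
  then have "\<exists>U'\<subseteq>U. \<rho> ^ M' * real (card U) \<le> real (card U') \<and>
      (\<forall>v\<in>U'. real (card {x\<in>U'. heavy \<delta> E \<Y>' v x}) \<le> \<rho> * real (card U'))"
    by (intro clique_or_sparse_subset finU \<rho>(1) \<open>\<rho> \<le> 1\<close>) (simp_all add: heavy_sym, simp add: heavy_def)
  then obtain U' where U': "U' \<subseteq> U" "\<rho> ^ M' * real (card U) \<le> real (card U')"
    "\<forall>v\<in>U'. real (card {x\<in>U'. heavy \<delta> E \<Y>' v x}) \<le> \<rho> * real (card U')"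
    by blast
  have "real w * K ^ s \<le> (K * \<rho> ^ M') * (real w * K ^ s)"
    using K(1) K1 mult_right_mono[of 1 "K * \<rho> ^ M'" "real w * K ^ s"] by simp
  also have "\<dots> = \<rho> ^ M' * (real w * K ^ Suc s)" by simp
  also have "\<dots> \<le> \<rho> ^ M' * real (card U)" using Suc.prems \<rho> by (intro mult_left_mono) auto
  finally have "real w * K ^ s \<le> real (card U')" using U' by linarith
  moreover have "U' \<subseteq> V" using U' Suc.prems by blast
  ultimately obtain W where W: "W \<subseteq> U'" "card W = s * w"
    "card {(v, x). v \<in> W \<and> x \<in> W \<and> heavy \<delta> E \<Y>' v x} \<le> 2 * s * w\<^sup>2"
    "card {e\<in>E. e \<subseteq> W} \<le> 13 * s\<^sup>2 * w ^ 3"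
    using Suc.IH[OF \<Y>', of U'] U' by blast
  have sS: "s \<le> S" using Suc.prems by simp
  have small: "\<delta> * real s \<le> 1" "8 * \<rho> * real s \<le> 1"
    using \<delta> \<rho> sS mult_left_mono[of "real s" "real S" \<delta>] mult_left_mono[of "real s" "real S" "8 * \<rho>"]
    by linarith+
  have large: "2 * (s + 1) * w \<le> card U"
    using sS by (intro order.trans[OF mult_le_mono1 cU]) simp
  have "W \<subseteq> U" using W(1) U'(1) by blast
  then show ?case
    unfolding Suc_eq_plus1
    by (rule sparse_union_step[OF H Suc.prems(4) large \<open>w > 0\<close> _ W(2) \<delta>(1) small(1) \<rho>(1) small(2)
          Suc.prems(6) W(3)[unfolded \<Y>'_def] W(4)])
qed

lemma binomial_3_lower:
  assumes "6 \<le> u"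
  shows "real u ^ 3 \<le> 12 * real (u choose 3)"
proof -
  have "3 * (u choose 3) = u * ((u - 1) choose 2)" "2 * ((u - 1) choose 2) = (u - 1) * ((u - 1 - 1) choose 1)"
    using times_binomial_minus1_eq[of 3 u] times_binomial_minus1_eq[of 2 "u - 1"] by simp_all
  then have "2 * (3 * (u choose 3)) = u * ((u - 1) * (u - 2))"
    by (metis (no_types, lifting) mult.left_commute diff_diff_left choose_one one_add_one)
  then have "real (2 * (3 * (u choose 3))) = real (u * ((u - 1) * (u - 2)))" by (simp only:)
  then have "6 * real (u choose 3) = real u * ((real u - 1) * (real u - 2))"
    using assms by (simp add: of_nat_diff)
  moreover have "real u * real u ^ 2 \<le> real u * (2 * ((real u - 1) * (real u - 2)))"
  proof (intro mult_left_mono)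
    have "0 \<le> (real u - 6) * real u" using assms by simp
    then show "real u ^ 2 \<le> 2 * ((real u - 1) * (real u - 2))" by (simp add: power2_eq_square algebra_simps)
  qed simp
  ultimately show ?thesis by (simp add: power2_eq_square power3_eq_cube)
qed

text \<open>The bound \<open>\<delta>\<close> on the relative codegree must not depend on the size \<open>M\<close> of the clique; this is
  what forces the codegree to be measured in a set \<open>Y\<close> that depends on the hypergraph.\<close>

lemma unif_dense_heavy_clique:
  fixes d :: real
  assumes "d > 0"
  shows "\<exists>\<delta>>0. \<forall>M y0. \<exists>\<eta>>0. \<exists>n0. \<forall>(V::'a set) E. three_graph V E \<and> unif_dense d \<eta> V E \<and> n0 \<le> card V \<longrightarrow>
    (\<exists>Y\<subseteq>V. y0 \<le> card Y \<and> (\<exists>T\<subseteq>V. card T = M \<and>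
      (\<forall>v\<in>T. \<forall>x\<in>T. v \<noteq> x \<longrightarrow> \<delta> * real (card Y) \<le> real (rel_codeg E Y v x))))"
proof -
  \<comment> \<open>The \<open>S\<close> pieces of size \<open>w\<close> span at most
    \<open>13 * S\<^sup>2 * w ^ 3\<close> edges and the \<eta>-term costs another
    \<open>w ^ 3\<close>, while the main term of the density bound is at least
    \<open>d * (S * w) ^ 3 / 12\<close>. These clash once \<open>d * S\<close> exceeds 168 = 12 *
    14. The summand 6 is for \<open>binomial_3_lower\<close>. \<open>S\<close>, and hence \<delta>,
    depends on \<open>d\<close> alone.\<close>
  define S where "S = nat \<lceil>168 / d\<rceil> + 6"
  have S6: "6 \<le> S" by (simp add: S_def)
  have "168 / d < real S" unfolding S_def by linarith
  then have dS: "168 < d * real S" using assms by (simp add: pos_divide_less_eq mult.commute)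
  define \<delta> \<rho> where "\<delta> = 1 / real S" and "\<rho> = 1 / (8 * real S)"
  have \<delta>: "0 < \<delta>" "\<delta> * real S \<le> 1" and \<rho>: "0 < \<rho>" "8 * \<rho> * real S \<le> 1"
    using S6 by (auto simp: \<delta>_def \<rho>_def)
  show ?thesis
  proof (rule exI[of _ \<delta>], intro conjI allI)
    fix M y0 :: nat
    obtain M' where M': "\<And>(\<Y>::'a set set) E \<delta> T. finite \<Y> \<and> card \<Y> \<le> S \<and> finite T \<and> card T = M' \<and>
      (\<forall>v\<in>T. \<forall>x\<in>T. v \<noteq> x \<longrightarrow> heavy \<delta> E \<Y> v x) \<Longrightarrow>
      (\<exists>Y\<in>\<Y>. \<exists>T'\<subseteq>T. card T' = M + 2 \<and> (\<forall>v\<in>T'. \<forall>x\<in>T'. v \<noteq> x \<longrightarrow> heavy \<delta> E {Y} v x))"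
      using heavy_clique_single[of S M] by metis
    define K where "K = max (1 / \<rho> ^ M') (2 * (real S + 1))"
    have K: "1 \<le> K * \<rho> ^ M'" "2 * (real S + 1) \<le> K"
    proof -
      have "(1 / \<rho> ^ M') * \<rho> ^ M' \<le> K * \<rho> ^ M'" using \<rho> by (intro mult_right_mono) (auto simp: K_def)
      then show "1 \<le> K * \<rho> ^ M'" using \<rho> by simp
    qed (simp add: K_def)
    have K1: "1 \<le> K" using K(2) of_nat_0_le_iff[of S] by (simp add: algebra_simps)
    define c where "c = K ^ S"
    have c: "c \<ge> 1" using K1 by (simp add: c_def)
    \<comment> \<open>With \<open>w\<close> the integer part of \<open>card V / c\<close>, these
      choices give \<open>w \<ge> y0\<close> and \<open>w \<ge> card V / (2 * c)\<close>, so that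
      \<open>\<eta> * card V ^ 3\<close> is at most \<open>w ^ 3\<close>.\<close>
    define n0 where "n0 = nat \<lceil>c * (real y0 + 2)\<rceil>"
    define \<eta> where "\<eta> = 1 / (2 * c) ^ 3"
    show "\<exists>\<eta>>0. \<exists>n0. \<forall>(V::'a set) E. three_graph V E \<and> unif_dense d \<eta> V E \<and> n0 \<le> card V \<longrightarrow>
      (\<exists>Y\<subseteq>V. y0 \<le> card Y \<and> (\<exists>T\<subseteq>V. card T = M \<and>
      (\<forall>v\<in>T. \<forall>x\<in>T. v \<noteq> x \<longrightarrow> \<delta> * real (card Y) \<le> real (rel_codeg E Y v x))))"
    proof (intro exI[of _ \<eta>] exI[of _ n0] conjI allI impI)
      show "\<eta> > 0" using c by (simp add: \<eta>_def)
      fix V :: "'a set" and E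
      assume "three_graph V E \<and> unif_dense d \<eta> V E \<and> n0 \<le> card V"
      then have H: "three_graph V E" and dense: "unif_dense d \<eta> V E" and n: "n0 \<le> card V" by auto
      have finV: "finite V" using H by (simp add: three_graph_def)
      define w where "w = nat \<lfloor>real (card V) / c\<rfloor>"
      have "c * (real y0 + 2) \<le> real (card V)" using n unfolding n0_def by linarith
      then have nc: "real y0 + 2 \<le> real (card V) / c" using c by (simp add: pos_le_divide_eq mult.commute)
      then have w: "y0 \<le> w" "0 < w" "real w \<le> real (card V) / c" "real (card V) / c \<le> 2 * real w"
        unfolding w_def by linarith+
      have \<eta>n: "\<eta> * real (card V) ^ 3 \<le> real w ^ 3"
      proof -
        have "\<eta> * real (card V) ^ 3 = (real (card V) / c / 2) ^ 3"
          by (simp add: \<eta>_def power_divide power_mult_distrib)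
        also have "\<dots> \<le> real w ^ 3" using w c by (intro power_mono) auto
        finally show ?thesis .
      qed
      show "\<exists>Y\<subseteq>V. y0 \<le> card Y \<and> (\<exists>T\<subseteq>V. card T = M \<and>
        (\<forall>v\<in>T. \<forall>x\<in>T. v \<noteq> x \<longrightarrow> \<delta> * real (card Y) \<le> real (rel_codeg E Y v x)))"
      proof (rule ccontr)
        assume none: "\<not> ?thesis"
        have noclique: "\<not> (\<exists>T\<subseteq>V. card T = M' \<and> (\<forall>v\<in>T. \<forall>x\<in>T. v \<noteq> x \<longrightarrow> heavy \<delta> E \<Y> v x))"
          if \<Y>: "finite \<Y>" "card \<Y> \<le> S" "\<forall>Y\<in>\<Y>. Y \<subseteq> V \<and> w \<le> card Y" for \<Y>
        proof
          assume "\<exists>T\<subseteq>V. card T = M' \<and> (\<forall>v\<in>T. \<forall>x\<in>T. v \<noteq> x \<longrightarrow> heavy \<delta> E \<Y> v x)"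
          then obtain T where T: "T \<subseteq> V" "card T = M'" "\<forall>v\<in>T. \<forall>x\<in>T. v \<noteq> x \<longrightarrow> heavy \<delta> E \<Y> v x" by blast
          then have "finite T" using finV finite_subset by blast
          then obtain Y T' where YT: "Y \<in> \<Y>" "T' \<subseteq> T" "card T' = M + 2"
            "\<forall>v\<in>T'. \<forall>x\<in>T'. v \<noteq> x \<longrightarrow> heavy \<delta> E {Y} v x"
            using M'[of \<Y> T \<delta> E] \<Y> T by blast
          obtain T2 where T2: "T2 \<subseteq> T'" "card T2 = M"
            using obtain_subset_with_card_n[of M T'] YT(3) by auto
          have "Y \<subseteq> V" "y0 \<le> card Y" using \<Y> YT(1) w(1) by force+
          moreover have "T2 \<subseteq> V" using T2 YT T by blast
          moreover have "\<forall>v\<in>T2. \<forall>x\<in>T2. v \<noteq> x \<longrightarrow> \<delta> * real (card Y) \<le> real (rel_codeg E Y v x)"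
            using YT(4) T2(1) by (auto simp: heavy_def)
          ultimately show False using none T2(2) by blast
        qed
        have "\<exists>W\<subseteq>V. card W = S * w \<and>
            card {(v, x). v \<in> W \<and> x \<in> W \<and> heavy \<delta> E {} v x} \<le> 2 * S * w\<^sup>2 \<and>
            card {e\<in>E. e \<subseteq> W} \<le> 13 * S\<^sup>2 * w ^ 3"
        \<comment> \<open>The start is \<open>U = V\<close> with the empty family: no pair is heavy,
          so the degree condition is trivial.\<close>
        proof (rule sparse_union[OF H w(2) _ \<delta> \<rho> K noclique])
          show "real w * K ^ S \<le> real (card V)"
            using w(3) c by (simp add: pos_le_divide_eq c_def)
          show "\<forall>v\<in>V. real (card {x\<in>V. heavy \<delta> E {} v x}) \<le> \<rho> * real (card V)"
            using \<rho> by (simp add: heavy_def)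
        qed (use S6 in simp_all)
        then obtain W where W: "W \<subseteq> V" "card W = S * w" "card {e\<in>E. e \<subseteq> W} \<le> 13 * S\<^sup>2 * w ^ 3"
          by blast
        have "1 * 6 \<le> w * S" using w(2) S6 by (intro mult_le_mono) auto
        then have u6: "6 \<le> S * w" by (simp add: mult.commute)
        have "d * real (S * w choose 3) - \<eta> * real (card V) ^ 3 \<le> real (card {e\<in>E. e \<subseteq> W})"
          using dense W by (auto simp: unif_dense_def)
        also have "\<dots> \<le> real (13 * S\<^sup>2 * w ^ 3)" using W(3) unfolding of_nat_le_iff .
        also have "\<dots> = 13 * real S ^ 2 * real w ^ 3" by simp
        finally have up: "d * real (S * w choose 3) \<le> 13 * real S ^ 2 * real w ^ 3 + real w ^ 3"
          using \<eta>n by linarith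
        have "d * real (S * w) ^ 3 \<le> d * (12 * real (S * w choose 3))"
          using binomial_3_lower[OF u6] assms by (intro mult_left_mono) auto
        also have "\<dots> = 12 * (d * real (S * w choose 3))" by simp
        also have "\<dots> \<le> 12 * (13 * real S ^ 2 * real w ^ 3 + real w ^ 3)"
          by (intro mult_left_mono up) simp
        finally have "d * real (S * w) ^ 3 \<le> 12 * (13 * real S ^ 2 * real w ^ 3 + real w ^ 3)" .
        then have "(d * real S * real S ^ 2) * real w ^ 3 \<le> (156 * real S ^ 2 + 12) * real w ^ 3"
          by (simp add: power2_eq_square power3_eq_cube algebra_simps)
        then have "d * real S * real S ^ 2 \<le> 156 * real S ^ 2 + 12" using w(2) by simp
        moreover have "168 * real S ^ 2 < d * real S * real S ^ 2" using dS S6 by (intro mult_strict_right_mono) auto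
        moreover have "1 \<le> real S ^ 2" using S6 by (simp add: one_le_power)
        ultimately show False by linarith
      qed
    qed
  qed (fact \<delta>)
qed

subsection \<open>Vanishing uniform density\<close>

text \<open>The set \<open>Y\<close> takes the role of the ground set in
  \<open>simultaneous_patterns\<close>. The length \<open>M\<close> required there depends on
  \<delta>, so \<delta> has to be known before a clique of that length is requested. The size of
  \<open>Y\<close> turns the proportion \<kappa> into \<open>l\<close> actual vertices.\<close>

lemma unif_dense_ordered_patterns:
  fixes d :: real and t l :: nat
  assumes "d > 0"
  shows "\<exists>\<eta>>0. \<exists>n0. \<forall>(V::'a set) E. three_graph V E \<and> unif_dense d \<eta> V E \<and> n0 \<le> card V \<longrightarrow>
    (\<exists>a. inj_on a {..<t} \<and> a ` {..<t} \<subseteq> V \<and>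
      (\<forall>L\<subseteq>{..<t}. l \<le> card {b\<in>V. \<forall>j<t. \<forall>i<j. i \<in> L \<and> j \<notin> L \<longrightarrow> {a i, a j, b} \<in> E}))"
proof -
  obtain \<delta> where "\<delta> > 0" and clique: "\<forall>M y0. \<exists>\<eta>>0. \<exists>n0. \<forall>(V::'a set) E.
    three_graph V E \<and> unif_dense d \<eta> V E \<and> n0 \<le> card V \<longrightarrow>
    (\<exists>Y\<subseteq>V. y0 \<le> card Y \<and> (\<exists>T\<subseteq>V. card T = M \<and>
      (\<forall>v\<in>T. \<forall>x\<in>T. v \<noteq> x \<longrightarrow> \<delta> * real (card Y) \<le> real (rel_codeg E Y v x))))"
    using unif_dense_heavy_clique[OF assms, where 'a = 'a] by (elim exE conjE) (rule that)
  obtain M \<kappa> where "\<kappa> > 0" and pat: "\<forall>(V::'a set) C. finite V \<and> V \<noteq> {} \<and>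
      (\<forall>j<M. \<forall>i<j. \<delta> * real (card V) \<le> real (card {b\<in>V. C i j b})) \<longrightarrow>
      (\<exists>a. strict_mono_on {..<t} a \<and> a ` {..<t} \<subseteq> {..<M::nat} \<and>
        (\<forall>L\<subseteq>{..<t}. \<kappa> * real (card V) \<le> real (card (pattern_hits V C t L a))))"
    using simultaneous_patterns[OF \<open>\<delta> > 0\<close>, where 'a = 'a and t = t] by (elim exE conjE) (rule that)
  define y0 where "y0 = nat \<lceil>real l / \<kappa>\<rceil> + 1"
  obtain \<eta> n0 where \<eta>: "\<eta> > 0" and dense: "\<forall>(V::'a set) E.
    three_graph V E \<and> unif_dense d \<eta> V E \<and> n0 \<le> card V \<longrightarrow>
    (\<exists>Y\<subseteq>V. y0 \<le> card Y \<and> (\<exists>T\<subseteq>V. card T = M \<and>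
      (\<forall>v\<in>T. \<forall>x\<in>T. v \<noteq> x \<longrightarrow> \<delta> * real (card Y) \<le> real (rel_codeg E Y v x))))"
    using clique[THEN spec, of M, THEN spec, of y0] by (elim exE conjE) (rule that)
  show ?thesis
  proof (rule exI[of _ \<eta>], rule conjI[OF \<eta>], rule exI[of _ n0], intro allI impI)
    fix V :: "'a set" and E
    assume H: "three_graph V E \<and> unif_dense d \<eta> V E \<and> n0 \<le> card V"
    then have finV: "finite V" by (simp add: three_graph_def)
    obtain Y T where Y: "Y \<subseteq> V" "y0 \<le> card Y" and T: "T \<subseteq> V" "card T = M"
      and heavy: "\<forall>v\<in>T. \<forall>x\<in>T. v \<noteq> x \<longrightarrow> \<delta> * real (card Y) \<le> real (rel_codeg E Y v x)"
      using dense[THEN spec, THEN spec, THEN mp, OF H] by (elim exE conjE) (rule that)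
    have finY: "finite Y" "Y \<noteq> {}" using Y finV by (auto simp: y0_def intro: finite_subset)
    obtain g where g: "bij_betw g {0..<M} T"
      using ex_bij_betw_nat_finite[of T] T finV finite_subset by blast
    define C where "C i j b \<longleftrightarrow> {g i, g j, b} \<in> E" for i j b
    have "\<delta> * real (card Y) \<le> real (card {b\<in>Y. C i j b})" if "j < M" "i < j" for i j
    proof -
      have ij: "i \<in> {0..<M}" "j \<in> {0..<M}" "i \<noteq> j" using that by auto
      then have "g i \<noteq> g j" using bij_betw_imp_inj_on[OF g] by (meson inj_onD)
      then show ?thesis
        using heavy[rule_format, of "g i" "g j"] bij_betw_apply[OF g] ij by (simp add: C_def rel_codeg_def)
    qed
    then have "finite Y \<and> Y \<noteq> {} \<and> (\<forall>j<M. \<forall>i<j. \<delta> * real (card Y) \<le> real (card {b\<in>Y. C i j b}))"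
      using finY by simp
    from pat[THEN spec, THEN spec, THEN mp, OF this]
    obtain a where a: "strict_mono_on {..<t} a" "a ` {..<t} \<subseteq> {..<M}"
      and hits: "\<forall>L\<subseteq>{..<t}. \<kappa> * real (card Y) \<le> real (card (pattern_hits Y C t L a))"
      by (elim exE conjE) (rule that)
    have a': "a ` {..<t} \<subseteq> {0..<M}" using a(2) by auto
    show "\<exists>a. inj_on a {..<t} \<and> a ` {..<t} \<subseteq> V \<and>
      (\<forall>L\<subseteq>{..<t}. l \<le> card {b\<in>V. \<forall>j<t. \<forall>i<j. i \<in> L \<and> j \<notin> L \<longrightarrow> {a i, a j, b} \<in> E})"
    proof (intro exI[of _ "g \<circ> a"] conjI allI impI)
      show "inj_on (g \<circ> a) {..<t}"
        using strict_mono_on_imp_inj_on[OF a(1)] inj_on_subset[OF bij_betw_imp_inj_on[OF g] a']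
        by (rule comp_inj_on)
      show "(g \<circ> a) ` {..<t} \<subseteq> V"
        using a' bij_betw_imp_surj_on[OF g] T(1) by (auto simp: image_comp[symmetric])
      fix L assume "L \<subseteq> {..<t}"
      have "real l / \<kappa> \<le> real (card Y)" using Y(2) unfolding y0_def by linarith
      then have "real l \<le> \<kappa> * real (card Y)" using \<open>\<kappa> > 0\<close> by (simp add: pos_divide_le_eq mult.commute)
      also have "\<dots> \<le> real (card (pattern_hits Y C t L a))" using hits \<open>L \<subseteq> {..<t}\<close> by blast
      also have "card (pattern_hits Y C t L a)
          \<le> card {b\<in>V. \<forall>j<t. \<forall>i<j. i \<in> L \<and> j \<notin> L \<longrightarrow> {(g \<circ> a) i, (g \<circ> a) j, b} \<in> E}"
        using finV Y(1) by (intro card_mono) (auto simp: pattern_hits_def C_def)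
      finally show "l \<le> card {b\<in>V. \<forall>j<t. \<forall>i<j. i \<in> L \<and> j \<notin> L \<longrightarrow> {(g \<circ> a) i, (g \<circ> a) j, b} \<in> E}"
        by simp
    qed
  qed
qed

lemma greedy_distinct_representatives:
  assumes "finite Q" "finite X" "\<And>q. q \<in> Q \<Longrightarrow> card Q + card X \<le> card (B q)"
  shows "\<exists>\<beta>. inj_on \<beta> Q \<and> (\<forall>q\<in>Q. \<beta> q \<in> B q - X)"
  using assms
proof (induction Q arbitrary: X rule: finite_induct)
  case (insert q Q)
  have "\<not> B q \<subseteq> X"
    using insert.prems(2)[of q] insert.hyps card_mono[OF insert.prems(1), of "B q"] by auto
  then obtain b where b: "b \<in> B q" "b \<notin> X" by blast
  have "\<exists>\<beta>. inj_on \<beta> Q \<and> (\<forall>q\<in>Q. \<beta> q \<in> B q - insert b X)"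
    using insert.prems insert.hyps b by (intro insert.IH) auto
  then obtain \<beta> where \<beta>: "inj_on \<beta> Q" "\<forall>q\<in>Q. \<beta> q \<in> B q - insert b X" by blast
  have "inj_on (\<beta>(q := b)) (insert q Q)"
    using \<beta> insert.hyps by (auto simp: inj_on_def)
  moreover have "\<forall>r\<in>insert q Q. (\<beta>(q := b)) r \<in> B r - X" using \<beta> b by auto
  ultimately show ?case by blast
qed auto

text \<open>By \<open>sides\<close>, no vertex of \<open>P\<close> is both a left and a right end in
  the link of the same \<open>q\<close>. With \<open>L q\<close> the ranks of the left ends, each
  link edge runs from a rank in \<open>L q\<close> to a later rank outside it and so belongs to the
  pattern of \<open>L q\<close>. A copy places \<open>P\<close> along the sequence and every other
  \<open>q\<close> on a hit of its own pattern.\<close>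

lemma pi_unif_one_sided_links:
  fixes VF :: "'b set" and pos :: "'b \<Rightarrow> nat"
  assumes F: "three_graph VF EF" and P: "P \<subseteq> VF" "inj_on pos P"
    and shape: "\<And>e. e \<in> EF \<Longrightarrow> \<exists>p\<in>P. \<exists>p'\<in>P. \<exists>q\<in>VF - P. e = {p, p', q} \<and> pos p < pos p'"
    and sides: "\<And>p1 p p2 q. \<lbrakk>p1 \<in> P; p \<in> P; p2 \<in> P; q \<in> VF - P; pos p1 < pos p; pos p < pos p2;
      {p1, p, q} \<in> EF\<rbrakk> \<Longrightarrow> {p, p2, q} \<notin> EF"
  shows "pi_unif VF EF \<le> 0"
proof -
  have fin: "finite VF" "finite P" using F P by (auto simp: three_graph_def intro: finite_subset)
  define t where "t = card P"
  define r where "r p = card {p'\<in>P. pos p' < pos p}" for p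
  have r_mono: "r p < r p'" if "p \<in> P" "p' \<in> P" "pos p < pos p'" for p p'
    unfolding r_def using that fin by (intro psubset_card_mono) auto
  have r_lt: "r p < t" if "p \<in> P" for p
    unfolding r_def t_def using that fin by (intro psubset_card_mono) auto
  have r_inj: "inj_on r P"
    using r_mono P(2) by (metis inj_onD inj_onI less_irrefl linorder_neqE_nat)
  define L where "L q = r ` {p\<in>P. \<exists>p'\<in>P. pos p < pos p' \<and> {p, p', q} \<in> EF}" for q
  have L_sub: "L q \<subseteq> {..<t}" for q using r_lt by (auto simp: L_def)
  \<comment> \<open>Enough hits to pick distinct ones for all vertices outside \<open>P\<close>
    while avoiding the \<open>t\<close> images of \<open>P\<close>.\<close>
  define l where "l = card (VF - P) + t"
  have "d \<le> 0" if d: "d \<in> pi_unif_set VF EF" for d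
  proof (rule ccontr)
    assume "\<not> d \<le> 0"
    then have "d > 0" by simp
    obtain \<eta> n0 where "\<eta> > 0" and emb: "\<forall>(V::nat set) E.
      three_graph V E \<and> unif_dense d \<eta> V E \<and> n0 \<le> card V \<longrightarrow>
      (\<exists>a. inj_on a {..<t} \<and> a ` {..<t} \<subseteq> V \<and>
        (\<forall>L\<subseteq>{..<t}. l \<le> card {b\<in>V. \<forall>j<t. \<forall>i<j. i \<in> L \<and> j \<notin> L \<longrightarrow> {a i, a j, b} \<in> E}))"
      using unif_dense_ordered_patterns[OF \<open>d > 0\<close>, of t l, where 'a = nat] by (elim exE conjE) (rule that)
    obtain V :: "nat set" and E where VE: "three_graph V E" "\<not> has_copy VF EF V E" "unif_dense d \<eta> V E" "n0 \<le> card V"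
      using d \<open>\<eta> > 0\<close> unfolding pi_unif_set_def by blast
    obtain a where a: "inj_on a {..<t}" "a ` {..<t} \<subseteq> V"
      and hits: "\<forall>L\<subseteq>{..<t}. l \<le> card {b\<in>V. \<forall>j<t. \<forall>i<j. i \<in> L \<and> j \<notin> L \<longrightarrow> {a i, a j, b} \<in> E}"
      using emb[THEN spec, THEN spec, THEN mp, of V E] VE by (elim meta_impE exE conjE) auto
    define B where "B q = {b\<in>V. \<forall>j<t. \<forall>i<j. i \<in> L q \<and> j \<notin> L q \<longrightarrow> {a i, a j, b} \<in> E}" for q
    have "card (VF - P) + card (a ` {..<t}) \<le> card (B q)" for q
      using hits L_sub[of q] a(1) by (auto simp: B_def l_def card_image)
    then obtain \<beta> where \<beta>: "inj_on \<beta> (VF - P)" "\<forall>q\<in>VF - P. \<beta> q \<in> B q - a ` {..<t}"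
      using greedy_distinct_representatives[of "VF - P" "a ` {..<t}" B] fin by auto
    define f where "f v = (if v \<in> P then a (r v) else \<beta> v)" for v
    have "inj_on f VF"
    proof (rule inj_onI)
      fix x y assume xy: "x \<in> VF" "y \<in> VF" "f x = f y"
      show "x = y"
      proof (cases "x \<in> P"; cases "y \<in> P")
        assume "x \<in> P" "y \<in> P"
        then show ?thesis using xy a(1) r_lt r_inj by (auto simp: f_def dest!: inj_onD)
      next
        assume "x \<notin> P" "y \<notin> P"
        then show ?thesis using xy \<beta>(1) by (auto simp: f_def dest: inj_onD)
      qed (use xy \<beta>(2) r_lt in \<open>force simp: f_def\<close>)+
    qed
    moreover have "f ` VF \<subseteq> V" using a(2) r_lt \<beta>(2) by (auto simp: f_def B_def)
    moreover have "f ` e \<in> E" if "e \<in> EF" for e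
    proof -
      obtain p p' q where e: "p \<in> P" "p' \<in> P" "q \<in> VF - P" "e = {p, p', q}" "pos p < pos p'"
        using shape[OF \<open>e \<in> EF\<close>] by blast
      have "r p \<in> L q" using e that by (auto simp: L_def)
      moreover have "r p' \<notin> L q"
      proof
        assume "r p' \<in> L q"
        then obtain p'' p2 where "p'' \<in> P" "r p' = r p''" "p2 \<in> P" "pos p'' < pos p2" "{p'', p2, q} \<in> EF"
          by (auto simp: L_def)
        moreover from this have "p'' = p'" using r_inj e by (auto dest: inj_onD)
        ultimately show False using sides[of p p' p2 q] e that by auto
      qed
      moreover have "\<beta> q \<in> B q" using \<beta>(2) e by auto
      ultimately have "{a (r p), a (r p'), \<beta> q} \<in> E"
        using r_mono[of p p'] r_lt[of p'] e by (auto simp: B_def)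
      then show ?thesis using e by (auto simp: f_def insert_commute)
    qed
    ultimately show False using VE(2) unfolding has_copy_def by blast
  qed
  then show ?thesis by (auto simp: pi_unif_def intro: cSup_least)
qed

subsection \<open>The cyclic block construction\<close>

text \<open>The doubling step passes from H to the matrix with block rows (H, H) and (H, -H). Rows
  with different residues modulo \<open>N\<close> are orthogonal on each half; distinct rows with
  the same residue agree on the first half and are opposite on the second.\<close>

lemma Sylvester_rows:
  "\<exists>s :: nat \<Rightarrow> nat \<Rightarrow> real. (\<forall>x y. s x y = 1 \<or> s x y = -1) \<and> (\<forall>y. s 0 y = 1) \<and>
    (\<forall>x<2 ^ m. \<forall>x'<2 ^ m. x \<noteq> x' \<longrightarrow> (\<Sum>y<2 ^ m. s x y * s x' y) = 0)"
proof (induction m)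
  case 0
  then show ?case by (intro exI[of _ "\<lambda>_ _. 1"]) auto
next
  case (Suc m)
  then obtain s :: "nat \<Rightarrow> nat \<Rightarrow> real" where s: "\<And>x y. s x y = 1 \<or> s x y = -1" "\<And>y. s 0 y = 1"
    "\<And>x x'. \<lbrakk>x < 2 ^ m; x' < 2 ^ m; x \<noteq> x'\<rbrakk> \<Longrightarrow> (\<Sum>y<2 ^ m. s x y * s x' y) = 0" by metis
  define N :: nat where "N = 2 ^ m"
  have N: "N > 0" "2 ^ Suc m = N + N" by (simp_all add: N_def)
  define s' where "s' x y = s (x mod N) (y mod N) * (if x \<ge> N \<and> y \<ge> N then -1 else 1)" for x y
  have orth: "(\<Sum>y<N + N. s' x y * s' x' y) = 0" if x: "x < N + N" "x' < N + N" "x \<noteq> x'" for x x'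
  proof -
    define e :: "nat \<Rightarrow> real" where "e x = (if x \<ge> N then -1 else 1)" for x
    define T where "T = (\<Sum>y<N. s (x mod N) y * s (x' mod N) y)"
    have "(\<Sum>y<N + N. s' x y * s' x' y) = (\<Sum>y<N. s' x y * s' x' y) + (\<Sum>y<N. s' x (y + N) * s' x' (y + N))"
      using sum.atLeastLessThan_concat[of 0 N "N + N" "\<lambda>y. s' x y * s' x' y"]
        sum.shift_bounds_nat_ivl[of "\<lambda>y. s' x y * s' x' y" 0 N N]
      by (simp add: atLeast0LessThan)
    also have "(\<Sum>y<N. s' x y * s' x' y) = T"
      unfolding T_def by (intro sum.cong) (auto simp: s'_def)
    also have "(\<Sum>y<N. s' x (y + N) * s' x' (y + N)) = e x * e x' * T"
      unfolding T_def sum_distrib_left by (intro sum.cong) (auto simp: s'_def e_def)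
    also have "T + e x * e x' * T = 0"
    proof (cases "x mod N = x' mod N")
      case True
      have "x div N \<noteq> x' div N" using True x(3) by (metis div_mult_mod_eq)
      moreover have "z div N = (if z \<ge> N then 1 else 0)" if "z < N + N" for z
        using that N(1) by (auto simp: div_nat_eqI)
      ultimately have "e x * e x' = -1" using x by (auto simp: e_def split: if_splits)
      then show ?thesis by simp
    next
      case False
      then have "T = 0" unfolding T_def using s(3)[of "x mod N" "x' mod N"] N(1) by (simp add: N_def)
      then show ?thesis by simp
    qed
    finally show ?thesis .
  qed
  have "s' x y = 1 \<or> s' x y = -1" for x y using s(1)[of "x mod N" "y mod N"] by (auto simp: s'_def)
  moreover have "s' 0 y = 1" for y using s(2) N(1) by (simp add: s'_def)
  ultimately show ?case using orth unfolding N(2) by (intro exI[of _ s']) blast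
qed

text \<open>For signs p and q, the expression 1 + p - q - pq is 4 if p = 1 and q = -1, and 0
  otherwise. Summed over the columns, the product vanishes by orthogonality, and so does row
  \<open>x'\<close>, which is not row 0 and hence orthogonal to the all-ones row. Row
  \<open>x\<close> may be row 0, but its sum is not negative.\<close>

lemma separating_rows:
  "\<exists>h :: nat \<Rightarrow> nat \<Rightarrow> bool. \<forall>x' x. x < x' \<and> x' < 2 ^ m \<longrightarrow>
    2 ^ m \<le> 4 * card {y. y < 2 ^ m \<and> \<not> h x y \<and> h x' y}"
proof -
  obtain s :: "nat \<Rightarrow> nat \<Rightarrow> real" where s: "\<And>x y. s x y = 1 \<or> s x y = -1" "\<And>y. s 0 y = 1"
    and orth: "\<And>x x'. \<lbrakk>x < 2 ^ m; x' < 2 ^ m; x \<noteq> x'\<rbrakk> \<Longrightarrow> (\<Sum>y<2 ^ m. s x y * s x' y) = 0"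
    using Sylvester_rows[of m] by metis
  define h where "h x y \<longleftrightarrow> s x y = -1" for x y
  have row_sum: "(\<Sum>y<2 ^ m. s x y) \<ge> 0" "x > 0 \<longrightarrow> (\<Sum>y<2 ^ m. s x y) = 0" if "x < 2 ^ m" for x
    using orth[of 0 x] s(2) that by (cases "x = 0"; simp)+
  have "2 ^ m \<le> 4 * card {y. y < 2 ^ m \<and> \<not> h x y \<and> h x' y}" if x: "x < x'" "x' < 2 ^ m" for x x'
  proof -
    have "4 * of_bool (\<not> h x y \<and> h x' y) = 1 + s x y - s x' y - s x y * s x' y" for y
      using s(1)[of x y] s(1)[of x' y] by (auto simp: h_def)
    then have "(\<Sum>y<2 ^ m. 4 * of_bool (\<not> h x y \<and> h x' y)) =
        (\<Sum>y<2 ^ m. 1 + s x y - s x' y - s x y * s x' y)" by simp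
    also have "\<dots> \<ge> 2 ^ m"
      using row_sum[of x] row_sum[of x'] orth[of x x'] x by (simp add: sum.distrib sum_subtractf)
    finally have "2 ^ m \<le> (\<Sum>y<2 ^ m. 4 * of_bool (\<not> h x y \<and> h x' y) :: real)" .
    also have "\<dots> = 4 * real (card ({..<2 ^ m} \<inter> {y. \<not> h x y \<and> h x' y}))"
      by (simp add: sum_distrib_left[symmetric] of_bool_def sum.If_cases)
    also have "{..<2 ^ m} \<inter> {y. \<not> h x y \<and> h x' y} = {y. y < 2 ^ m \<and> \<not> h x y \<and> h x' y}" by auto
    finally have "real (2 ^ m) \<le> real (4 * card {y. y < 2 ^ m \<and> \<not> h x y \<and> h x' y})" by simp
    then show ?thesis unfolding of_nat_le_iff .
  qed
  then show ?thesis by (intro exI[of _ h]) blast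
qed

text \<open>Vertices are written as pairs (block, position in the block). The offset of block \<open>i\<close> from the
  centre \<open>c\<close> is its signed cyclic distance, between \<open>-k\<close> and \<open>k\<close>.\<close>

definition offset :: "nat \<Rightarrow> nat \<Rightarrow> nat \<Rightarrow> int" where
  "offset k c i = (int i - int c + int k) mod (2 * int k + 1) - int k"

lemma offset_bounds: "- int k \<le> offset k c i" "offset k c i \<le> int k"
proof -
  have "(int i - int c + int k) mod (2 * int k + 1) < 2 * int k + 1" by (rule pos_mod_bound) simp
  moreover have "0 \<le> (int i - int c + int k) mod (2 * int k + 1)" by (rule pos_mod_sign) simp
  ultimately show "- int k \<le> offset k c i" "offset k c i \<le> int k" unfolding offset_def by linarith+
qed

lemma offset_cong: "offset k c i mod (2 * int k + 1) = (int i - int c) mod (2 * int k + 1)"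
  unfolding offset_def by (simp add: mod_diff_left_eq)

lemma offset_onto:
  assumes "- int k \<le> v" "v \<le> int k"
  obtains i where "i < 2 * k + 1" "offset k c i = v"
proof
  define i where "i = nat ((int c + v) mod (2 * int k + 1))"
  have "0 \<le> (int c + v) mod (2 * int k + 1)" "(int c + v) mod (2 * int k + 1) < 2 * int k + 1"
    by (rule pos_mod_sign, simp, rule pos_mod_bound, simp)
  then have i: "int i = (int c + v) mod (2 * int k + 1)" "i < 2 * k + 1" unfolding i_def by linarith+
  have "(int i - int c + int k) mod (2 * int k + 1) = (int c + v - int c + int k) mod (2 * int k + 1)"
    unfolding i(1) by (metis mod_add_left_eq mod_diff_left_eq)
  also have "\<dots> = v + int k" using assms by (simp add: mod_pos_pos_trivial)
  finally show "offset k c i = v" by (simp add: offset_def)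
  show "i < 2 * k + 1" by (fact i)
qed

text \<open>\<open>k + 1\<close> is the inverse of 2 modulo \<open>2 * k + 1\<close>, so
  \<open>c\<close> is the midpoint of \<open>i\<close> and \<open>j\<close> on the circle. The sum
  of the offsets is then a multiple of \<open>2 * k + 1\<close>, and too small to be any but
  0.\<close>

lemma offset_opposite:
  obtains c where "c < 2 * k + 1" "offset k c i + offset k c j = 0"
proof
  define K where "K = 2 * int k + 1"
  define c where "c = nat (((int i + int j) * (int k + 1)) mod K)"
  have K: "K > 0" by (simp add: K_def)
  have "0 \<le> ((int i + int j) * (int k + 1)) mod K" "((int i + int j) * (int k + 1)) mod K < K"
    using K by simp_all
  then have c: "int c = ((int i + int j) * (int k + 1)) mod K" "c < 2 * k + 1" unfolding c_def K_def by linarith+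
  have "(offset k c i + offset k c j) mod K = ((int i - int c) + (int j - int c)) mod K"
    unfolding K_def by (metis mod_add_eq offset_cong)
  also have "\<dots> = ((int i + int j) - 2 * int c) mod K" by (simp add: algebra_simps)
  also have "\<dots> = ((int i + int j) - 2 * ((int i + int j) * (int k + 1))) mod K"
    unfolding c(1) by (metis mod_diff_right_eq mod_mult_right_eq)
  also have "(int i + int j) - 2 * ((int i + int j) * (int k + 1)) = - (int i + int j) * K"
    by (simp add: K_def algebra_simps)
  finally have "K dvd offset k c i + offset k c j" by (simp add: dvd_eq_mod_eq_0)
  moreover have "\<bar>offset k c i + offset k c j\<bar> < K"
    using offset_bounds[of k c i] offset_bounds[of k c j] unfolding K_def by linarith
  ultimately show "offset k c i + offset k c j = 0" by (metis dvd_imp_le_int abs_of_pos K not_less)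
  show "c < 2 * k + 1" by (fact c)
qed

lemma offset_inj:
  assumes "i < 2 * k + 1" "j < 2 * k + 1" "offset k c i = offset k c j"
  shows "i = j"
proof -
  have "(int i - int c) mod (2 * int k + 1) = (int j - int c) mod (2 * int k + 1)"
    using assms(3) offset_cong by metis
  then have "(int i - int c + int c) mod (2 * int k + 1) = (int j - int c + int c) mod (2 * int k + 1)"
    by (metis mod_add_left_eq)
  then show ?thesis using assms by (simp add: mod_pos_pos_trivial)
qed

section \<open>Links of the construction and the circle cut open\<close>

text \<open>For a vertex \<open>x\<close> of the central block, \<open>h x y\<close> decides which
  way it faces: left if true, right if false. Two central vertices are joined when they face each
  other, and each central vertex is joined to the whole adjacent block that it faces. The last three
  disjuncts name the left end first.\<close>

definition arc :: "(nat \<Rightarrow> nat \<Rightarrow> bool) \<Rightarrow> nat \<Rightarrow> nat \<times> nat \<Rightarrow> nat \<times> nat \<Rightarrow> nat \<times> nat \<Rightarrow> bool" where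
  "arc h k b a a' \<longleftrightarrow> (case (b, a, a') of ((c, y), (i, x), (j, x')) \<Rightarrow>
     offset k c i + offset k c j = 0 \<and> offset k c i \<noteq> 0 \<or>
     offset k c i = 0 \<and> offset k c j = 0 \<and> x < x' \<and> \<not> h x y \<and> h x' y \<or>
     offset k c i = 0 \<and> offset k c j = 1 \<and> \<not> h x y \<or>
     offset k c i = -1 \<and> offset k c j = 0 \<and> h x' y)"

text \<open>The place of block \<open>i\<close> when the circle is read from \<open>x0\<close> on.
  \<open>x0\<close> itself gets 0, so a nonzero value says that the deleted block is
  avoided.\<close>

definition cut_block :: "nat \<Rightarrow> nat \<Rightarrow> nat \<Rightarrow> nat" where
  "cut_block k x0 i = nat ((int i - int x0) mod (2 * int k + 1))"

text \<open>\<open>s\<close> is the place of the centre. As \<open>u + s\<close> lies strictly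
  between \<open>- K\<close> and \<open>2 * K\<close> for K = 2k + 1, one correction by K replaces
  the remainder and leaves linear arithmetic.\<close>

lemma cut_block_offset:
  assumes "s = (int c - int x0) mod (2 * int k + 1)"
  shows "int (cut_block k x0 i) = (let u = offset k c i in
    if u + s < 0 then u + s + (2 * int k + 1) else if u + s \<ge> 2 * int k + 1 then u + s - (2 * int k + 1) else u + s)"
proof -
  define K where "K = 2 * int k + 1"
  define u where "u = offset k c i"
  have K: "K > 0" by (simp add: K_def)
  have "int (cut_block k x0 i) = (int i - int x0) mod K"
    using K by (simp add: cut_block_def K_def)
  also have "int i - int x0 = (int i - int c) + (int c - int x0)" by simp
  also have "\<dots> mod K = (u + s) mod K"
    unfolding assms u_def K_def by (metis mod_add_eq mod_mod_trivial offset_cong)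
  also have "\<dots> = (if u + s < 0 then u + s + K else if u + s \<ge> K then u + s - K else u + s)"
  proof -
    have "0 \<le> s" "s < K" using K unfolding assms K_def by (rule pos_mod_sign, rule pos_mod_bound)
    moreover have "- int k \<le> u" "u \<le> int k" unfolding u_def by (rule offset_bounds)+
    ultimately have b: "- K < u + s" "u + s < 2 * K" using K_def by linarith+
    have shift: "(u + s) mod K = (u + s + K) mod K" "(u + s) mod K = (u + s - K) mod K" by simp_all
    consider "u + s < 0" | "u + s \<ge> K" | "0 \<le> u + s" "u + s < K" by linarith
    then show ?thesis
    proof cases
      case 1
      then have "(u + s + K) mod K = u + s + K" using b by (intro mod_pos_pos_trivial) auto
      with 1 shift(1) show ?thesis by presburger
    next
      case 2
      then have "(u + s - K) mod K = u + s - K" using b by (intro mod_pos_pos_trivial) auto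
      moreover have "\<not> u + s < 0" using 2 K by linarith
      ultimately show ?thesis using shift(2) 2 by presburger
    next
      case 3
      then show ?thesis by (simp add: mod_pos_pos_trivial)
    qed
  qed
  finally show ?thesis by (simp add: Let_def u_def K_def)
qed

text \<open>Deleting one block cuts the cyclic order of the blocks open; in the resulting linear order all
  neighbours of a vertex lie on the same side.\<close>

lemma arc_one_sided:
  assumes "k > 0"
    and n1: "arc h k (c, y) (i1, x1) (i, x) \<or> arc h k (c, y) (i, x) (i1, x1)"
    and n2: "arc h k (c, y) (i2, x2) (i, x) \<or> arc h k (c, y) (i, x) (i2, x2)"
    and ne: "cut_block k x0 i1 \<noteq> 0" "cut_block k x0 i \<noteq> 0" "cut_block k x0 i2 \<noteq> 0"
    and l1: "cut_block k x0 i1 < cut_block k x0 i \<or> cut_block k x0 i1 = cut_block k x0 i \<and> x1 < x"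
    and l2: "cut_block k x0 i < cut_block k x0 i2 \<or> cut_block k x0 i = cut_block k x0 i2 \<and> x < x2"
  shows False
proof -
  define s where "s = (int c - int x0) mod (2 * int k + 1)"
  have s: "0 \<le> s" "s < 2 * int k + 1" unfolding s_def by (rule pos_mod_sign, simp, rule pos_mod_bound, simp)
  define u u1 u2 where "u = offset k c i" and "u1 = offset k c i1" and "u2 = offset k c i2"
  note cb = cut_block_offset[OF s_def, unfolded Let_def]
  define D D1 D2 where "D = int (cut_block k x0 i)" and "D1 = int (cut_block k x0 i1)" and "D2 = int (cut_block k x0 i2)"
  have D: "D = (if u + s < 0 then u + s + (2 * int k + 1) else if u + s \<ge> 2 * int k + 1 then u + s - (2 * int k + 1) else u + s)"
    "D1 = (if u1 + s < 0 then u1 + s + (2 * int k + 1) else if u1 + s \<ge> 2 * int k + 1 then u1 + s - (2 * int k + 1) else u1 + s)"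
    "D2 = (if u2 + s < 0 then u2 + s + (2 * int k + 1) else if u2 + s \<ge> 2 * int k + 1 then u2 + s - (2 * int k + 1) else u2 + s)"
    unfolding D_def D1_def D2_def u_def u1_def u2_def by (rule cb)+
  have ub: "- int k \<le> u" "u \<le> int k" "- int k \<le> u1" "u1 \<le> int k" "- int k \<le> u2" "u2 \<le> int k"
    unfolding u_def u1_def u2_def by (rule offset_bounds)+
  have Dne: "D \<noteq> 0" "D1 \<noteq> 0" "D2 \<noteq> 0" using ne by (simp_all add: D_def D1_def D2_def)
  have L1: "D1 < D \<or> D1 = D \<and> x1 < x" and L2: "D < D2 \<or> D = D2 \<and> x < x2"
    using l1 l2 by (auto simp: D_def D1_def D2_def)
  have nb: "u + v = 0 \<and> u \<noteq> 0 \<or> u = 0 \<and> v = 0 \<and> (z < x \<and> h x y \<or> x < z \<and> \<not> h x y) \<or>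
      u = 0 \<and> v = 1 \<and> \<not> h x y \<or> u = 0 \<and> v = -1 \<and> h x y \<or> (u = 1 \<or> u = -1) \<and> v = 0"
    if "arc h k (c, y) (l, z) (i, x) \<or> arc h k (c, y) (i, x) (l, z)" "v = offset k c l" for l z v
    using that unfolding arc_def u_def prod.case by (elim disjE conjE) auto
  note N1 = nb[OF n1 u1_def] and N2 = nb[OF n2 u2_def]
  define q where "q = int k"
  have q: "q \<ge> 1" using assms(1) by (simp add: q_def)
  note D = D[folded q_def] and s = s[folded q_def] and ub = ub[folded q_def]
  \<comment> \<open>\<open>u\<close> is the offset of the middle vertex. In the centre,
    \<open>h x y\<close> settles the side. For \<open>u\<close> = 1 or -1 the neighbours lie in the
    centre and in block \<open>- u\<close>; having one on the wrong side forces
    \<open>s = 0\<close>, so the deleted block is the centre and only block \<open>- u\<close>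
    remains. Otherwise all neighbours lie in block \<open>- u\<close>.\<close>
  consider "u = 0" "h x y" | "u = 0" "\<not> h x y" | "u = 1" | "u = -1" | "u \<noteq> 0" "u \<noteq> 1" "u \<noteq> -1" by blast
  then show False
  proof cases
    case 1
    then have u2: "u2 = 0 \<and> x2 < x \<or> u2 = -1" using N2 by auto
    have Ds: "D = s" using D(1) 1 s by simp
    from u2 show False
    proof (elim disjE conjE)
      assume "u2 = 0" "x2 < x"
      then have "D2 = s" using D(3) s by simp
      then show False using Ds L2 \<open>x2 < x\<close> by auto
    next
      assume "u2 = -1"
      then have "D2 = s - 1" using D(3) s Ds Dne(1) by (simp split: if_splits)
      then show False using Ds L2 by auto
    qed
  next
    case 2
    then have u1: "u1 = 0 \<and> x < x1 \<or> u1 = 1" using N1 by auto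
    have Ds: "D = s" using D(1) 2 s by simp
    from u1 show False
    proof (elim disjE conjE)
      assume "u1 = 0" "x < x1"
      then have "D1 = s" using D(2) s by simp
      then show False using Ds L1 \<open>x < x1\<close> by auto
    next
      assume "u1 = 1"
      then have "D1 = s + 1" using D(2) s Dne(2) by (simp split: if_splits)
      then show False using Ds L1 by auto
    qed
  next
    case 3
    then have u12: "u1 = 0 \<or> u1 = -1" "u2 = 0 \<or> u2 = -1" using N1 N2 by auto
    have Ds: "D = s + 1" using D(1) 3 Dne(1) s by (simp split: if_splits)
    have "s = 0" using u12(2)
    proof
      assume "u2 = 0"
      then have "D2 = s" using D(3) s by simp
      then show ?thesis using Ds L2 by auto
    next
      assume "u2 = -1"
      then have "D2 = s - 1 \<or> s = 0" using D(3) s by (simp split: if_splits)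
      then show ?thesis using Ds L2 by auto
    qed
    from u12(1) show False
    proof
      assume "u1 = 0"
      then have "D1 = 0" using D(2) \<open>s = 0\<close> q by simp
      then show False using Dne by simp
    next
      assume "u1 = -1"
      then have "D1 = 2 * q" using D(2) \<open>s = 0\<close> by simp
      then show False using Ds \<open>s = 0\<close> L1 q by auto
    qed
  next
    case 4
    then have u12: "u1 = 0 \<or> u1 = 1" "u2 = 0 \<or> u2 = 1" using N1 N2 by auto
    have Ds: "D = s - 1 \<or> s = 0" using D(1) 4 s by (simp split: if_splits)
    have "s = 0" using u12(1)
    proof
      assume "u1 = 0"
      then have "D1 = s" using D(2) s by simp
      then show ?thesis using Ds L1 by auto
    next
      assume "u1 = 1"
      then have "D1 = s + 1" using D(2) Dne(2) s by (simp split: if_splits)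
      then show ?thesis using Ds L1 by auto
    qed
    then have D2q: "D = 2 * q" using D(1) 4 by simp
    from u12(2) show False
    proof
      assume "u2 = 0"
      then have "D2 = 0" using D(3) \<open>s = 0\<close> q by simp
      then show False using Dne by simp
    next
      assume "u2 = 1"
      then have "D2 = 1" using D(3) \<open>s = 0\<close> q by simp
      then show False using D2q L2 q by auto
    qed
  next
    case 5
    then have u12: "u1 = - u" "u2 = - u" using N1 N2 by auto
    then have "D1 = D2" using D by simp
    then have "D1 = D" using L1 L2 by auto
    then show False using D(1,2)[unfolded u12] 5(1) ub(1,2) by (simp split: if_splits)
  qed
qed

lemma arc_irrefl: "\<not> arc h k b a a"
  by (auto simp: arc_def split: prod.splits)

lemma cut_block_inj:
  assumes "i < 2 * k + 1" "j < 2 * k + 1" "cut_block k x0 i = cut_block k x0 j"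
  shows "i = j"
proof -
  have "(int i - int x0) mod (2 * int k + 1) = (int j - int x0) mod (2 * int k + 1)"
    using assms(3) pos_mod_sign[of "2 * int k + 1"] by (simp add: cut_block_def eq_nat_nat_iff)
  then have "(int i - int x0 + int x0) mod (2 * int k + 1) = (int j - int x0 + int x0) mod (2 * int k + 1)"
    by (metis mod_add_left_eq)
  then show ?thesis using assms by (simp add: mod_pos_pos_trivial)
qed

lemma codeg_ge_card:
  assumes "finite E" "\<And>v. v \<in> N \<Longrightarrow> insert v S \<in> E" "N \<inter> S = {}"
  shows "card N \<le> codeg E S"
proof -
  have "inj_on (\<lambda>v. insert v S) N" using assms(3) by (auto simp: inj_on_def)
  then have "card N = card ((\<lambda>v. insert v S) ` N)" by (simp add: card_image)
  also have "\<dots> \<le> card {e\<in>E. S \<subseteq> e}" using assms by (intro card_mono) auto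
  finally show ?thesis by (simp add: codeg_def)
qed

section \<open>The hypergraph, its codegrees and its small subgraphs\<close>

context
  fixes k X :: nat and h :: "nat \<Rightarrow> nat \<Rightarrow> bool"
  assumes k: "k > 0" and X: "X > 0"
    and sep: "\<forall>x' x. x < x' \<and> x' < X \<longrightarrow> X \<le> 4 * card {y. y < X \<and> \<not> h x y \<and> h x' y}"
begin

definition "num = (2 * k + 1) * X"
definition "low = {..<num}"
definition "high = {num..<2 * num}"
text \<open>On \<open>low\<close> the pair is block and position; on \<open>high\<close> it is the
  centre and the second argument of \<open>h\<close>.\<close>

definition "coords v = (if v < num then (v div X, v mod X) else ((v - num) div X, (v - num) mod X))"
definition "adjacent b a a' \<longleftrightarrow> arc h k (coords b) (coords a) (coords a') \<or> arc h k (coords b) (coords a') (coords a)"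
definition "cyc_edges = {{a, a', b} | a a' b. a \<in> low \<and> a' \<in> low \<and> b \<in> high \<and> adjacent b a a'}"

lemma low_high: "finite low" "finite high" "low \<inter> high = {}" "card low = num" "card high = num"
  by (auto simp: low_def high_def)

lemma adjacent_sym: "adjacent b a a' \<Longrightarrow> adjacent b a' a"
  by (auto simp: adjacent_def)

lemma adjacent_neq: "adjacent b a a' \<Longrightarrow> a \<noteq> a'"
  by (auto simp: adjacent_def arc_irrefl)

lemma cyc_edgeE:
  assumes "e \<in> cyc_edges"
  obtains a a' b where "a \<in> low" "a' \<in> low" "b \<in> high" "adjacent b a a'" "e = {a, a', b}"
  using assms by (auto simp: cyc_edges_def)

lemma cyc_edge_iff:
  assumes "a \<in> low" "a' \<in> low" "b \<in> high"
  shows "{a, a', b} \<in> cyc_edges \<longleftrightarrow> adjacent b a a'"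
proof
  assume "{a, a', b} \<in> cyc_edges"
  then obtain c c' d where c: "c \<in> low" "c' \<in> low" "d \<in> high" "adjacent d c c'" "{a, a', b} = {c, c', d}"
    by (rule cyc_edgeE)
  have "{a, a', b} \<inter> high = {b}" "{c, c', d} \<inter> high = {d}"
    using assms c low_high(3) by auto
  then have "b = d" using c(5) by simp
  have "{a, a', b} \<inter> low = {a, a'}" "{c, c', d} \<inter> low = {c, c'}"
    using assms c low_high(3) by auto
  then have "{a, a'} = {c, c'}" using c(5) by simp
  then show "adjacent b a a'" using c(4) \<open>b = d\<close> by (auto simp: doubleton_eq_iff adjacent_sym)
qed (use assms in \<open>auto simp: cyc_edges_def\<close>)

lemma cyc_three_graph: "three_graph (low \<union> high) cyc_edges"
  unfolding three_graph_def
proof (intro conjI ballI)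
  fix e assume "e \<in> cyc_edges"
  then obtain a a' b where e: "a \<in> low" "a' \<in> low" "b \<in> high" "adjacent b a a'" "e = {a, a', b}"
    by (rule cyc_edgeE)
  then show "e \<subseteq> low \<union> high" by auto
  have "a \<noteq> a'" "a \<noteq> b" "a' \<noteq> b" using e adjacent_neq low_high(3) by auto
  then show "card e = 3" using e by simp
qed (use low_high in simp)

lemma finite_cyc_edges: "finite cyc_edges"
proof (rule finite_subset)
  show "cyc_edges \<subseteq> Pow (low \<union> high)" by (auto elim!: cyc_edgeE)
qed (use low_high in simp)

lemma cyc_edge_type:
  assumes "e \<in> cyc_edges"
  shows "card (e \<inter> low) = 2" "card (e \<inter> high) = 1"
proof -
  obtain a a' b where e: "a \<in> low" "a' \<in> low" "b \<in> high" "adjacent b a a'" "e = {a, a', b}"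
    using assms by (rule cyc_edgeE)
  then have "e \<inter> low = {a, a'}" "e \<inter> high = {b}" using low_high(3) by auto
  then show "card (e \<inter> low) = 2" "card (e \<inter> high) = 1" using adjacent_neq[OF e(4)] by auto
qed

lemma low_vertex:
  assumes "i < 2 * k + 1" "x < X"
  shows "i * X + x \<in> low" "coords (i * X + x) = (i, x)"
proof -
  have "i * X + x < (i + 1) * X" using assms by simp
  also have "\<dots> \<le> num" unfolding num_def using assms by (intro mult_le_mono1) simp
  finally show "i * X + x \<in> low" "coords (i * X + x) = (i, x)"
    using assms by (auto simp: low_def coords_def)
qed

lemma high_vertex:
  assumes "i < 2 * k + 1" "x < X"
  shows "num + (i * X + x) \<in> high" "coords (num + (i * X + x)) = (i, x)"
  using low_vertex[OF assms] assms by (auto simp: low_def high_def coords_def)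

lemma low_coords:
  assumes "a \<in> low"
  shows "coords a = (a div X, a mod X)" "a div X < 2 * k + 1" "a mod X < X"
  using assms X by (auto simp: low_def coords_def num_def less_mult_imp_div_less)

lemma high_coords:
  assumes "b \<in> high"
  obtains c y where "coords b = (c, y)" "c < 2 * k + 1" "y < X"
  using assms X by (auto simp: high_def coords_def num_def less_mult_imp_div_less)

text \<open>Two different blocks are opposite with respect to their midpoint, and all
  \<open>X\<close> vertices of \<open>high\<close> with that centre serve. Inside one block that
  block is the centre, and the separating columns, at least a quarter of all, serve.\<close>

lemma cyc_codeg_low:
  assumes a: "a \<in> low" "a' \<in> low" "a \<noteq> a'"
  shows "X \<le> 4 * codeg cyc_edges {a, a'}"
proof -
  have many: "card Z \<le> codeg cyc_edges {a, a'}"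
    if cK: "c < 2 * k + 1" and Z: "Z \<subseteq> {..<X}" and arcs: "\<And>y. y \<in> Z \<Longrightarrow> arc h k (c, y) (coords a) (coords a') \<or> arc h k (c, y) (coords a') (coords a)" for c Z
  proof -
    define N where "N = (\<lambda>y. num + (c * X + y)) ` Z"
    have b: "b \<in> high \<and> adjacent b a a'" if "b \<in> N" for b
    proof -
      obtain y where y: "y \<in> Z" "b = num + (c * X + y)" using \<open>b \<in> N\<close> by (auto simp: N_def)
      then have "y < X" using Z by auto
      then show ?thesis using high_vertex[OF cK] arcs[OF y(1)] y(2) by (simp add: adjacent_def)
    qed
    have "card Z = card N" by (simp add: N_def card_image inj_on_def)
    also have "\<dots> \<le> codeg cyc_edges {a, a'}"
    proof (rule codeg_ge_card[OF finite_cyc_edges])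
      show "insert v {a, a'} \<in> cyc_edges" if "v \<in> N" for v
        using cyc_edge_iff[OF a(1,2), of v] b[OF that] by (simp add: insert_commute)
      show "N \<inter> {a, a'} = {}" using b a low_high(3) by blast
    qed
    finally show ?thesis .
  qed
  note ca = low_coords[OF a(1)] and ca' = low_coords[OF a(2)]
  show ?thesis
  proof (cases "a div X = a' div X")
    case False
    obtain c where c: "c < 2 * k + 1" "offset k c (a div X) + offset k c (a' div X) = 0"
      by (rule offset_opposite)
    have "offset k c (a div X) \<noteq> 0" using c False offset_inj[OF ca(2) ca'(2), of c] by auto
    then have "card {..<X} \<le> codeg cyc_edges {a, a'}"
      using c ca ca' by (intro many[of c]) (auto simp: arc_def)
    then show ?thesis by simp
  next
    case True
    define c where "c = a div X"
    have c: "c < 2 * k + 1" "offset k c c = 0" using ca by (auto simp: c_def offset_def)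
    have "a mod X \<noteq> a' mod X" using True a(3) by (metis div_mult_mod_eq)
    then consider "a mod X < a' mod X" | "a' mod X < a mod X" by linarith
    then show ?thesis
    proof cases
      case 1
      then have "X \<le> 4 * card {y. y < X \<and> \<not> h (a mod X) y \<and> h (a' mod X) y}" using ca' sep by simp
      also have "card {y. y < X \<and> \<not> h (a mod X) y \<and> h (a' mod X) y} \<le> codeg cyc_edges {a, a'}"
        using c 1 ca ca' True by (intro many[of c]) (auto simp: arc_def c_def)
      finally show ?thesis by simp
    next
      case 2
      then have "X \<le> 4 * card {y. y < X \<and> \<not> h (a' mod X) y \<and> h (a mod X) y}" using ca sep by simp
      also have "card {y. y < X \<and> \<not> h (a' mod X) y \<and> h (a mod X) y} \<le> codeg cyc_edges {a, a'}"
        using c 2 ca ca' True by (intro many[of c]) (auto simp: arc_def c_def)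
      finally show ?thesis by simp
    qed
  qed
qed

text \<open>In every link each vertex sees a whole block: the opposite one, or, from the centre, the
  adjacent block that it faces. Arcs inside the central block would not suffice, since its last
  position has no partner there when it faces right.\<close>

lemma cyc_codeg_mixed:
  assumes a: "a \<in> low" and b: "b \<in> high"
  shows "X \<le> codeg cyc_edges {a, b}"
proof -
  note ca = low_coords[OF a]
  obtain c y where cb: "coords b = (c, y)" "c < 2 * k + 1" "y < X" by (rule high_coords[OF b])
  define u where "u = offset k c (a div X)"
  have many: ?thesis if jK: "j < 2 * k + 1" and arcs: "\<And>x'. arc h k (c, y) (a div X, a mod X) (j, x') \<or> arc h k (c, y) (j, x') (a div X, a mod X)" for j
  proof -
    define N where "N = (\<lambda>x. j * X + x) ` {..<X}"
    have N: "v \<in> low \<and> adjacent b a v" if "v \<in> N" for v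
    proof -
      obtain x where x: "x < X" "v = j * X + x" using \<open>v \<in> N\<close> by (auto simp: N_def)
      then show ?thesis using low_vertex[OF jK] arcs[of x] ca cb by (simp add: adjacent_def)
    qed
    have "X = card N" by (simp add: N_def card_image inj_on_def)
    also have "\<dots> \<le> codeg cyc_edges {a, b}"
    proof (rule codeg_ge_card[OF finite_cyc_edges])
      show "insert v {a, b} \<in> cyc_edges" if "v \<in> N" for v
        using cyc_edge_iff[OF a _ b, of v] N[OF that] by (simp add: insert_commute)
      show "N \<inter> {a, b} = {}" using N a b low_high(3) adjacent_neq by blast
    qed
    finally show ?thesis .
  qed
  have k1: "int k \<ge> 1" using k by simp
  consider "u \<noteq> 0" | "u = 0" "\<not> h (a mod X) y" | "u = 0" "h (a mod X) y" by blast
  then show ?thesis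
  proof cases
    case 1
    obtain j where "j < 2 * k + 1" "offset k c j = - u"
      using offset_onto[of k "- u" c] offset_bounds[of k c "a div X"] by (auto simp: u_def)
    then show ?thesis using 1 by (intro many[of j]) (auto simp: arc_def u_def)
  next
    case 2
    obtain j where "j < 2 * k + 1" "offset k c j = 1" using offset_onto[of k 1 c] k1 by auto
    then show ?thesis using 2 by (intro many[of j]) (auto simp: arc_def u_def)
  next
    case 3
    obtain j where "j < 2 * k + 1" "offset k c j = -1" using offset_onto[of k "-1" c] k1 by auto
    then show ?thesis using 3 by (intro many[of j]) (auto simp: arc_def u_def)
  qed
qed

lemma cyc_small_subgraphs:
  fixes VF :: "nat set"
  assumes F: "three_graph VF EF" "card VF \<le> k" and copy: "has_copy VF EF (low \<union> high) cyc_edges"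
  shows "pi_unif VF EF \<le> 0"
proof -
  obtain f where f: "inj_on f VF" "f ` VF \<subseteq> low \<union> high" "\<forall>e\<in>EF. f ` e \<in> cyc_edges"
    using copy by (auto simp: has_copy_def)
  have finVF: "finite VF" using F by (simp add: three_graph_def)
  define P where "P = {v\<in>VF. f v \<in> low}"
  define blocks where "blocks = (\<lambda>v. f v div X) ` P"
  have "card blocks \<le> card P" unfolding blocks_def P_def using finVF by (intro card_image_le) simp
  also have "\<dots> \<le> k" using F(2) card_mono[OF finVF, of P] by (auto simp: P_def)
  finally have "card blocks < card {..<2 * k + 1}" by simp
  then have "\<not> {..<2 * k + 1} \<subseteq> blocks"
    using card_mono[of blocks "{..<2 * k + 1}"] finVF by (auto simp: blocks_def P_def not_less)
  then obtain x0 where x0: "x0 < 2 * k + 1" "x0 \<notin> blocks" by auto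
  define cb where "cb v = cut_block k x0 (f v div X)" for v
  define pos where "pos v = cb v * X + f v mod X" for v
  have Plow: "f v \<in> low" "v \<in> VF" if "v \<in> P" for v using that by (auto simp: P_def)
  have cb_ne: "cb v \<noteq> 0" if "v \<in> P" for v
  proof
    assume "cb v = 0"
    then have "f v div X = x0"
      using cut_block_inj[OF low_coords(2)[OF Plow(1)[OF that]] x0(1), of x0] by (simp add: cb_def cut_block_def)
    then show False using x0 that by (auto simp: blocks_def)
  qed
  have pos_less: "cb v < cb w \<or> cb v = cb w \<and> f v mod X < f w mod X" if "pos v < pos w" for v w
  proof (cases "cb w < cb v")
    case True
    then have "(cb w + 1) * X \<le> cb v * X" by (intro mult_le_mono1) simp
    then have "pos w < pos v" using mod_less_divisor[OF X, of "f w"] unfolding pos_def by simp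
    then show ?thesis using that by simp
  next
    case False
    then show ?thesis using that by (auto simp: pos_def)
  qed
  have pos_inj: "inj_on pos P"
  proof (rule inj_onI)
    fix v w assume vw: "v \<in> P" "w \<in> P" "pos v = pos w"
    have "pos v div X = cb v" "pos v mod X = f v mod X" "pos w div X = cb w" "pos w mod X = f w mod X"
      using X by (simp_all add: pos_def)
    then have eq: "cb v = cb w" "f v mod X = f w mod X" using vw(3) by simp_all
    then have "f v div X = f w div X"
      using cut_block_inj low_coords(2) Plow vw by (metis cb_def)
    then have "f v = f w" using eq(2) by (metis div_mult_mod_eq)
    then show "v = w" using f(1) Plow vw by (auto dest: inj_onD)
  qed
  show ?thesis
  proof (rule pi_unif_one_sided_links[OF F(1), where P = P and pos = pos])
    show "P \<subseteq> VF" by (auto simp: P_def)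
    show "inj_on pos P" by (fact pos_inj)
    show "\<exists>p\<in>P. \<exists>p'\<in>P. \<exists>q\<in>VF - P. e = {p, p', q} \<and> pos p < pos p'" if e: "e \<in> EF" for e
    proof -
      have eV: "e \<subseteq> VF" using F(1) e by (auto simp: three_graph_def)
      obtain a a' b where ab: "a \<in> low" "a' \<in> low" "b \<in> high" "adjacent b a a'" "f ` e = {a, a', b}"
        using f(3) e by (meson cyc_edgeE)
      have "a \<in> f ` e" "a' \<in> f ` e" "b \<in> f ` e" using ab(5) by auto
      then obtain p p' q where pq: "p \<in> e" "f p = a" "p' \<in> e" "f p' = a'" "q \<in> e" "f q = b" by auto
      have mem: "p \<in> P" "p' \<in> P" "q \<in> VF - P" using pq ab eV low_high(3) by (auto simp: P_def)
      have "f ` e = f ` {p, p', q}" using ab(5) pq by simp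
      then have e_eq: "e = {p, p', q}"
        using inj_on_image_eq_iff[OF f(1), of e "{p, p', q}"] eV mem by (auto simp: P_def)
      have "p \<noteq> p'" using adjacent_neq[OF ab(4)] pq by auto
      then have "pos p \<noteq> pos p'" using pos_inj mem by (auto dest: inj_onD)
      then consider "pos p < pos p'" | "pos p' < pos p" by linarith
      then show ?thesis
      proof cases
        case 1
        then show ?thesis using mem e_eq by blast
      next
        case 2
        have "e = {p', p, q}" using e_eq by auto
        then show ?thesis using 2 mem by blast
      qed
    qed
    show "{p, p2, q} \<notin> EF"
      if p: "p1 \<in> P" "p \<in> P" "p2 \<in> P" "q \<in> VF - P" "pos p1 < pos p" "pos p < pos p2" "{p1, p, q} \<in> EF" for p1 p p2 q
    proof
      assume e2: "{p, p2, q} \<in> EF"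
      have q: "f q \<in> high" using p(4) f(2) by (auto simp: P_def)
      obtain c y where cb: "coords (f q) = (c, y)" by (rule high_coords[OF q])
      have "f ` {p1, p, q} \<in> cyc_edges" "f ` {p, p2, q} \<in> cyc_edges" using f(3) p(7) e2 by blast+
      then have "adjacent (f q) (f p1) (f p)" "adjacent (f q) (f p) (f p2)"
        using cyc_edge_iff[OF Plow(1)[OF p(1)] Plow(1)[OF p(2)] q]
          cyc_edge_iff[OF Plow(1)[OF p(2)] Plow(1)[OF p(3)] q] by simp_all
      then have n: "arc h k (c, y) (f p1 div X, f p1 mod X) (f p div X, f p mod X) \<or>
          arc h k (c, y) (f p div X, f p mod X) (f p1 div X, f p1 mod X)"
        "arc h k (c, y) (f p2 div X, f p2 mod X) (f p div X, f p mod X) \<or>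
          arc h k (c, y) (f p div X, f p mod X) (f p2 div X, f p2 mod X)"
        using low_coords(1)[OF Plow(1)[OF p(1)]] low_coords(1)[OF Plow(1)[OF p(2)]]
          low_coords(1)[OF Plow(1)[OF p(3)]] cb unfolding adjacent_def by simp_all blast
      show False
        by (rule arc_one_sided[OF k n, where ?x0.0 = x0])
          (use cb_ne[of p1] cb_ne[of p] cb_ne[of p2] pos_less[of p1 p] pos_less[of p p2] p in \<open>auto simp: cb_def\<close>)
    qed
  qed
qed

lemma cyc_hypergraph:
  "\<exists>(A::nat set) (B::nat set) (E::nat set set).
      finite A \<and> finite B \<and> A \<inter> B = {} \<and> card A = (2 * k + 1) * X \<and> card B = (2 * k + 1) * X \<and>
      three_graph (A \<union> B) E \<and>
      (\<forall>e\<in>E. card (e \<inter> A) = 2 \<and> card (e \<inter> B) = 1) \<and>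
      (\<forall>a1\<in>A. \<forall>a2\<in>A. a1 \<noteq> a2 \<longrightarrow> X \<le> 4 * codeg E {a1, a2}) \<and>
      (\<forall>a\<in>A. \<forall>b\<in>B. X \<le> codeg E {a, b}) \<and>
      (\<forall>(VF::nat set) (EF::nat set set). three_graph VF EF \<and> card VF \<le> k \<and> pi_unif VF EF > 0
          \<longrightarrow> \<not> has_copy VF EF (A \<union> B) E)"
proof (rule exI[of _ low], rule exI[of _ high], rule exI[of _ cyc_edges], intro conjI allI ballI impI)
  fix VG :: "nat set" and EF :: "nat set set"
  show "\<not> has_copy VG EF (low \<union> high) cyc_edges"
    if "three_graph VG EF \<and> card VG \<le> k \<and> pi_unif VG EF > 0"
    using that cyc_small_subgraphs[of VG EF] by linarith
qed (use low_high cyc_three_graph cyc_edge_type cyc_codeg_low cyc_codeg_mixed in \<open>auto simp: num_def\<close>)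

end

theorem theorem3p2:
  fixes k :: nat
  assumes "k > 0"
  shows "\<exists>\<epsilon>::real. \<epsilon> > 0 \<and> infinite {n::nat. \<exists>(A::nat set) (B::nat set) (E::nat set set).
      finite A \<and> finite B \<and> A \<inter> B = {} \<and> card A = n \<and> card B = n \<and>
      three_graph (A \<union> B) E \<and>
      (\<forall>e\<in>E. card (e \<inter> A) = 2 \<and> card (e \<inter> B) = 1) \<and>
      (\<forall>a1\<in>A. \<forall>a2\<in>A. a1 \<noteq> a2 \<longrightarrow> real (codeg E {a1, a2}) \<ge> \<epsilon> * real n) \<and>
      (\<forall>a\<in>A. \<forall>b\<in>B. real (codeg E {a, b}) \<ge> \<epsilon> * real n) \<and>
      (\<forall>(VF::nat set) (EF::nat set set). three_graph VF EF \<and> card VF \<le> k \<and> pi_unif VF EF > 0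
          \<longrightarrow> \<not> has_copy VF EF (A \<union> B) E)}"
proof -
  define K where "K = 2 * k + 1"
  \<comment> \<open>Each part has \<open>n = K * X\<close> vertices, and the weaker codegree bound,
    for pairs within one block, is \<open>X / 4\<close>.\<close>
  define \<epsilon> :: real where "\<epsilon> = 1 / (4 * real K)"
  define good where "good n \<longleftrightarrow> (\<exists>(A::nat set) (B::nat set) (E::nat set set).
      finite A \<and> finite B \<and> A \<inter> B = {} \<and> card A = n \<and> card B = n \<and>
      three_graph (A \<union> B) E \<and>
      (\<forall>e\<in>E. card (e \<inter> A) = 2 \<and> card (e \<inter> B) = 1) \<and>
      (\<forall>a1\<in>A. \<forall>a2\<in>A. a1 \<noteq> a2 \<longrightarrow> real (codeg E {a1, a2}) \<ge> \<epsilon> * real n) \<and>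
      (\<forall>a\<in>A. \<forall>b\<in>B. real (codeg E {a, b}) \<ge> \<epsilon> * real n) \<and>
      (\<forall>(VF::nat set) (EF::nat set set). three_graph VF EF \<and> card VF \<le> k \<and> pi_unif VF EF > 0
          \<longrightarrow> \<not> has_copy VF EF (A \<union> B) E))" for n
  have "\<epsilon> > 0" by (simp add: \<epsilon>_def K_def)
  \<comment> \<open>Block sizes are powers of two because they are orders of Sylvester
    matrices.\<close>
  have "good (K * 2 ^ m)" for m
  proof -
    define X :: nat where "X = 2 ^ m"
    have X: "X > 0" by (simp add: X_def)
    obtain h :: "nat \<Rightarrow> nat \<Rightarrow> bool"
      where sep: "\<forall>x' x. x < x' \<and> x' < X \<longrightarrow> X \<le> 4 * card {y. y < X \<and> \<not> h x y \<and> h x' y}"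
      using separating_rows[of m] unfolding X_def by blast
    have \<epsilon>n: "\<epsilon> * real (K * X) = real X / 4"
    proof -
      have "real K \<noteq> 0" by (simp add: K_def)
      then show ?thesis by (simp add: \<epsilon>_def)
    qed
    obtain A B :: "nat set" and E where H: "finite A" "finite B" "A \<inter> B = {}" "card A = K * X" "card B = K * X"
      "three_graph (A \<union> B) E" "\<forall>e\<in>E. card (e \<inter> A) = 2 \<and> card (e \<inter> B) = 1"
      and c1: "\<forall>a1\<in>A. \<forall>a2\<in>A. a1 \<noteq> a2 \<longrightarrow> X \<le> 4 * codeg E {a1, a2}"
      and c2: "\<forall>a\<in>A. \<forall>b\<in>B. X \<le> codeg E {a, b}"
      and c3: "\<forall>(VF::nat set) (EF::nat set set). three_graph VF EF \<and> card VF \<le> k \<and> pi_unif VF EF > 0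
          \<longrightarrow> \<not> has_copy VF EF (A \<union> B) E"
      using cyc_hypergraph[OF assms X sep] unfolding K_def by blast
    have "\<forall>a1\<in>A. \<forall>a2\<in>A. a1 \<noteq> a2 \<longrightarrow> real (codeg E {a1, a2}) \<ge> \<epsilon> * real (K * X)"
    proof (intro ballI impI)
      fix a1 a2 assume "a1 \<in> A" "a2 \<in> A" "a1 \<noteq> a2"
      then have "X \<le> 4 * codeg E {a1, a2}" using c1 by blast
      then show "real (codeg E {a1, a2}) \<ge> \<epsilon> * real (K * X)" unfolding \<epsilon>n by linarith
    qed
    moreover have "\<forall>a\<in>A. \<forall>b\<in>B. real (codeg E {a, b}) \<ge> \<epsilon> * real (K * X)"
    proof (intro ballI)
      fix a b assume "a \<in> A" "b \<in> B"
      then have "X \<le> codeg E {a, b}" using c2 by blast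
      then show "real (codeg E {a, b}) \<ge> \<epsilon> * real (K * X)" unfolding \<epsilon>n by linarith
    qed
    ultimately show ?thesis
      unfolding good_def X_def[symmetric] using H c3 by (intro exI[of _ A] exI[of _ B] exI[of _ E] conjI)
  qed
  then have "range (\<lambda>m. K * 2 ^ m) \<subseteq> {n. good n}" by blast
  moreover have "K > 0" by (simp add: K_def)
  then have "infinite (range (\<lambda>m. K * 2 ^ m))" by (intro range_inj_infinite) (simp add: inj_def)
  ultimately have "infinite {n. good n}" by (rule infinite_super)
  with \<open>\<epsilon> > 0\<close> show ?thesis unfolding good_def by blast
qed

end
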